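(* Let $K=\mathbb{Q}(\sqrt{-11})$. The $11$-tent graph is a forest of trees in which every vertex has valence $4$. Consequently the group generated by the four matrices $$\begin{pmatrix}1&3&3&3\\0&-1&0&0\\0&0&-1&0\\0&0&0&-1\end{pmatrix},\ \begin{pmatrix}-1&0&0&0\\3&1&3&3\\0&0&-1&0\\0&0&0&-1\end{pmatrix},\ \begin{pmatrix}-1&0&0&0\\0&-1&0&0\\3&3&1&3\\0&0&0&-1\end{pmatrix},\ \begin{pmatrix}-1&0&0&0\\0&-1&0&0\\0&0&-1&0\\3&3&3&1\end{pmatrix}$$ is freely generated by them as a free product of four copies of $\mathbb{Z}/2\mathbb{Z}$.
   Context: Every oriented circle $C$ in $\widehat{\mathbb{C}}$ (lines included) is uniquely $\{X/Y: bX\overline{X}-aY\overline{X}-\overline{a}X\overline{Y}+b'Y\overline{Y}=0\}$ with $b,b'\in\mathbb{R}$, $a\in\mathbb{C}$, $bb'=|a|^2-1$, sign of $b$ = orientation, and for lines $a$ the unit normal pointing from exterior to interior. Set $v(C)=\pi(C)=(b',b,\mathrm{Re}\,a,\mathrm{Im}\,a)$ with Pedoe product $\langle(b'_1,b_1,r_1,m_1),(b'_2,b_2,r_2,m_2)\rangle=-\tfrac12(b'_1b_2+b_1b'_2)+r_1r_2+m_1m_2$. A $\mathbb{Q}(\sqrt{-11})$-Bianchi circle is $M(\widehat{\mathbb{R}})$, $M\in\mathrm{PSL}_2(\mathcal{O}_K)$. A tent is a 10-tuple $(C_1,\dots,C_{10})$ of oriented $\mathbb{Q}(\sqrt{-11})$-Bianchi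 circles with $v_i=\pi(C_i)$ whose Pedoe product matrix $(\langle v_i,v_j\rangle)$ has rows $(1,-1,-\tfrac92,-\tfrac{13}2,-\tfrac92,-1,-\tfrac92,-\tfrac{13}2,-\tfrac{13}2,-1)$, $(-1,1,-1,-\tfrac92,-\tfrac{13}2,-\tfrac92,-\tfrac{13}2,-\tfrac92,-10,-\tfrac92)$, $(-\tfrac92,-1,1,-1,-\tfrac92,-\tfrac{13}2,-\tfrac92,-1,-\tfrac{13}2,-\tfrac{13}2)$, $(-\tfrac{13}2,-\tfrac92,-1,1,-1,-\tfrac92,-\tfrac{13}2,-\tfrac92,-\tfrac92,-10)$, $(-\tfrac92,-\tfrac{13}2,-\tfrac92,-1,1,-1,-\tfrac92,-\tfrac{13}2,-1,-\tfrac{13}2)$, $(-1,-\tfrac92,-\tfrac{13}2,-\tfrac92,-1,1,-\tfrac{13}2,-10,-\tfrac92,-\tfrac92)$, $(-\tfrac92,-\tfrac{13}2,-\tfrac92,-\tfrac{13}2,-\tfrac92,-\tfrac{13}2,1,-1,-1,-1)$, $(-\tfrac{13}2,-\tfrac92,-1,-\tfrac92,-\tfrac{13}2,-10,-1,1,-\tfrac92,-\tfrac92)$, $(-\tfrac{13}2,-10,-\tfrac{13}2,-\tfrac92,-1,-\tfrac92,-1,-\tfrac92,1,-\tfrac92)$, $(-1,-\tfrac92,-\tfrac{13}2,-10,-\tfrac{13}2,-\tfrac92,-1,-\tfrac92,-\tfrac92,1)$. Its four belts are the six-circle sets $\{C_1,C_2,C_3,C_4,C_5,C_6\}$, $\{C_1,C_2,C_3,C_8,C_7,C_{10}\}$,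 $\{C_3,C_4,C_5,C_9,C_7,C_8\}$, $\{C_1,C_6,C_5,C_9,C_7,C_{10}\}$ (the cycles of tangent circles). The $11$-tent graph has as vertices all tents considered as unordered sets of circles, with an edge between tents sharing a belt. The four matrices act by right multiplication on the $4\times 4$ matrix with columns $v_1+v_4,\ v_1+v_8,\ v_1+v_9,\ v_3+v_9$ of a tent, each realising the replacement of a tent by the other tent sharing one of its belts. *)

theory Defs
  imports "HOL-Analysis.Analysis" "HOL-Algebra.Elementary_Groups"
    "HOL-Computational_Algebra.Polynomial"
begin

section \<open>Oriented circles in the Riemann sphere\<close>

text \<open>A point of the Riemann sphere is \<open>Some z\<close> or \<open>None\<close>, the point at infinity.\<close>

type_synonym riemann_sphere = "complex option"

definition quot :: "complex \<Rightarrow> complex \<Rightarrow> riemann_sphere" where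
  "quot X Y = (if Y = 0 then None else Some (X / Y))"

text \<open>An oriented circle is a circle together with the side of it that is its interior.
  The three kinds are: circle with bounded interior, circle whose interior contains infinity,
  and line, where \<open>n\<close> is the unit normal pointing into the interior.\<close>

type_synonym ocircle = "riemann_sphere set \<times> riemann_sphere set"

definition oriented_circles :: "ocircle set" where
  "oriented_circles =
     {(Some ` sphere c r, Some ` ball c r) | c r. r > 0}
   \<union> {(Some ` sphere c r, insert None (Some ` (- cball c r))) | c r. r > 0}
   \<union> {(insert None (Some ` {z. n \<bullet> z = k}), Some ` {z. n \<bullet> z > k}) | n k. norm n = 1}"

definition circle_eqn :: "real \<Rightarrow> real \<Rightarrow> complex \<Rightarrow> riemann_sphere set" where
  "circle_eqn b' b a = {quot X Y | X Y. (X, Y) \<noteq> (0, 0) \<and>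
     of_real b * X * cnj X - a * Y * cnj X - cnj a * X * cnj Y + of_real b' * Y * cnj Y = 0}"

text \<open>\<open>b > 0\<close> means that the interior is bounded. This is the choice of sign that is continuous
  with the one for lines, and for which externally tangent circles with disjoint interiors
  have Pedoe product \<open>-1\<close>.\<close>

definition has_coords :: "ocircle \<Rightarrow> real \<Rightarrow> real \<Rightarrow> complex \<Rightarrow> bool" where
  "has_coords C b' b a \<longleftrightarrow> b * b' = (norm a)\<^sup>2 - 1 \<and> fst C = circle_eqn b' b a \<and>
     (if b = 0 then \<forall>z. Some z \<in> fst C \<longrightarrow> Some (z + a) \<in> snd C
      else b > 0 \<longleftrightarrow> None \<notin> snd C)"

definition pedoe_vec :: "ocircle \<Rightarrow> real ^ 4" where
  "pedoe_vec C = (THE v. \<exists>b' b a. has_coords C b' b a \<and> v = vector [b', b, Re a, Im a])"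

lemma circle_eqn_line: "circle_eqn b' 0 a = insert None (Some ` {z. a \<bullet> z = b' / 2})"
proof -
  have *: "of_real b' * Y * cnj Y = a * Y * cnj X + cnj a * X * cnj Y \<longleftrightarrow> a \<bullet> (X / Y) = b' / 2" if "Y \<noteq> 0" for X Y :: complex
  proof -
    define z where "z = X / Y"
    have X: "X = z * Y" using that by (simp add: z_def)
    have "of_real b' * Y * cnj Y - (a * Y * cnj X + cnj a * X * cnj Y) = (of_real b' - of_real (2 * (a \<bullet> z))) * (Y * cnj Y)"
      unfolding X by (simp add: inner_complex_def complex_eq_iff algebra_simps)
    moreover have "Y * cnj Y \<noteq> 0" using that by simp
    ultimately have "of_real b' * Y * cnj Y - (a * Y * cnj X + cnj a * X * cnj Y) = 0 \<longleftrightarrow> of_real b' - (of_real (2 * (a \<bullet> z)) :: complex) = 0"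
      by simp
    also have "\<dots> \<longleftrightarrow> a \<bullet> z = b' / 2" by (auto simp flip: of_real_diff simp del: of_real_mult)
    finally show ?thesis by (simp add: z_def)
  qed
  show ?thesis
  proof (intro equalityI subsetI)
    fix p assume "p \<in> circle_eqn b' 0 a"
    then obtain X Y where "p = quot X Y" "(X, Y) \<noteq> (0,0)" "of_real b' * Y * cnj Y = a * Y * cnj X + cnj a * X * cnj Y"
      unfolding circle_eqn_def by (auto simp: algebra_simps)
    then show "p \<in> insert None (Some ` {z. a \<bullet> z = b' / 2})"
      using *[of Y X] by (auto simp: quot_def)
  next
    fix p assume p: "p \<in> insert None (Some ` {z. a \<bullet> z = b' / 2})"
    show "p \<in> circle_eqn b' 0 a"
    proof (cases p)
      case None
      show ?thesis unfolding circle_eqn_def None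
        by (intro CollectI exI[of _ 1] exI[of _ 0]) (simp add: quot_def)
    next
      case (Some z)
      then show ?thesis unfolding circle_eqn_def using p *[of 1 z]
        by (intro CollectI exI[of _ z] exI[of _ 1]) (auto simp: quot_def algebra_simps)
    qed
  qed
qed

lemma circle_eqn_circle:
  assumes "b \<noteq> 0" "b * b' = (norm a)\<^sup>2 - 1"
  shows "circle_eqn b' b a = Some ` sphere (a / of_real b) (1 / \<bar>b\<bar>)"
proof -
  have *: "of_real b * X * cnj X - a * Y * cnj X - cnj a * X * cnj Y + of_real b' * Y * cnj Y = 0 \<longleftrightarrow>
     X / Y \<in> sphere (a / of_real b) (1 / \<bar>b\<bar>)" if "Y \<noteq> 0" for X Y :: complex
  proof -
    define z where "z = X / Y"
    have X: "X = z * Y" using that by (simp add: z_def)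
    have b': "b' = ((norm a)\<^sup>2 - 1) / b" using assms by (simp add: field_simps)
    have "of_real b * (of_real b * X * cnj X - a * Y * cnj X - cnj a * X * cnj Y + of_real b' * Y * cnj Y) = of_real ((norm (of_real b * z - a))\<^sup>2 - 1) * (Y * cnj Y)"
    proof -
      have 1: "of_real b * of_real b' = (a * cnj a - 1 :: complex)"
        using assms(2) by (metis of_real_mult of_real_diff complex_norm_square of_real_1)
      have 2: "complex_of_real ((norm (of_real b * z - a))\<^sup>2) = (of_real b * z - a) * (of_real b * cnj z - cnj a)"
        by (simp only: complex_norm_square) simp
      have "of_real b * (of_real b * X * cnj X - a * Y * cnj X - cnj a * X * cnj Y + of_real b' * Y * cnj Y)
          = of_real b * (of_real b * X * cnj X - a * Y * cnj X - cnj a * X * cnj Y) + (of_real b * of_real b') * Y * cnj Y"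
        by (simp add: algebra_simps)
      then show ?thesis unfolding 1 of_real_diff 2 X by (simp add: algebra_simps)
    qed
    moreover have "Y * cnj Y \<noteq> 0" using that by simp
    ultimately have "of_real b * X * cnj X - a * Y * cnj X - cnj a * X * cnj Y + of_real b' * Y * cnj Y = 0 \<longleftrightarrow> complex_of_real ((norm (of_real b * z - a))\<^sup>2 - 1) = 0"
      using assms(1) by (metis mult_eq_0_iff of_real_eq_0_iff)
    also have "\<dots> \<longleftrightarrow> norm (of_real b * z - a) = 1"
      using power2_eq_iff_nonneg[of "norm (of_real b * z - a)" 1] by (simp only: of_real_eq_0_iff) simp
    also have "norm (of_real b * z - a) = \<bar>b\<bar> * dist (a / of_real b) z"
    proof -
      have "of_real b * z - a = of_real b * (z - a / of_real b)" using assms(1) by (simp add: field_simps)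
      then show ?thesis by (simp add: norm_mult dist_norm norm_minus_commute)
    qed
    also have "\<bar>b\<bar> * dist (a / of_real b) z = 1 \<longleftrightarrow> dist (a / of_real b) z = 1 / \<bar>b\<bar>"
      using assms(1) by (simp add: field_simps)
    finally show ?thesis by (simp add: z_def)
  qed
  show ?thesis
  proof (intro equalityI subsetI)
    fix p assume "p \<in> circle_eqn b' b a"
    then obtain X Y where XY: "p = quot X Y" "(X, Y) \<noteq> (0,0)" "of_real b * X * cnj X - a * Y * cnj X - cnj a * X * cnj Y + of_real b' * Y * cnj Y = 0"
      unfolding circle_eqn_def by blast
    have "Y \<noteq> 0" using XY assms(1) by auto
    then show "p \<in> Some ` sphere (a / of_real b) (1 / \<bar>b\<bar>)"
      using *[of Y X] XY by (simp add: quot_def)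
  next
    fix p assume p: "p \<in> Some ` sphere (a / of_real b) (1 / \<bar>b\<bar>)"
    then obtain z where z: "p = Some z" "z \<in> sphere (a / of_real b) (1 / \<bar>b\<bar>)" by blast
    then show "p \<in> circle_eqn b' b a"
      unfolding circle_eqn_def using *[of 1 z]
        by (intro CollectI exI[of _ z] exI[of _ 1]) (simp add: quot_def)
  qed
qed

lemma sphere_eqD:
  assumes "sphere (c::complex) r = sphere d s" "r > 0" "s > 0"
  shows "c = d \<and> r = s"
proof -
  have "convex hull (sphere c r) = cball c r" "convex hull (sphere d s) = cball d s"
    using Krein_Milman_frontier[of "cball c r"] Krein_Milman_frontier[of "cball d s"] by simp_all
  then have "cball c r = cball d s" using assms by simp
  then show ?thesis using assms by (simp add: cball_eq_cball_iff)
qed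

lemma has_coords_circle:
  assumes "r > 0" "\<epsilon> = 1 \<or> \<epsilon> = -1" "None \<in> I \<longleftrightarrow> \<epsilon> = -1"
  shows "has_coords (Some ` sphere c r, I) b' b a \<longleftrightarrow>
     b = \<epsilon> / r \<and> a = of_real (\<epsilon> / r) * c \<and> b' = \<epsilon> * ((norm c)\<^sup>2 - r\<^sup>2) / r" (is "?L \<longleftrightarrow> ?R")
proof
  assume L: ?L
  have b: "b \<noteq> 0"
  proof
    assume "b = 0"
    then have "None \<in> Some ` sphere c r" using L by (simp add: has_coords_def circle_eqn_line)
    then show False by blast
  qed
  have bb: "b * b' = (norm a)\<^sup>2 - 1" using L by (simp add: has_coords_def)
  have "Some ` sphere c r = Some ` sphere (a / of_real b) (1 / \<bar>b\<bar>)"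
    using L circle_eqn_circle[OF b bb] by (simp add: has_coords_def)
  then have "sphere c r = sphere (a / of_real b) (1 / \<bar>b\<bar>)" by (simp add: inj_image_eq_iff)
  then have e: "c = a / of_real b" "r = 1 / \<bar>b\<bar>" using sphere_eqD[of c r] assms(1) b by auto
  have "b > 0 \<longleftrightarrow> \<epsilon> = 1" using L b assms by (auto simp: has_coords_def)
  then have be: "b = \<epsilon> / r" unfolding e(2) using b assms(2) by auto
  have "a = of_real b * c" using e(1) b by simp
  then have a: "a = of_real (\<epsilon> / r) * c" unfolding be .
  have "b' = ((norm a)\<^sup>2 - 1) / b" using b bb by (simp add: field_simps)
  also have "\<dots> = \<epsilon> * ((norm c)\<^sup>2 - r\<^sup>2) / r"
    unfolding a be using assms(1,2) by (auto simp: norm_mult norm_divide field_simps power2_eq_square)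
  finally show ?R using be a by blast
next
  assume R: ?R
  have R': "b = \<epsilon> / r" "a = of_real (\<epsilon> / r) * c" "b' = \<epsilon> * ((norm c)\<^sup>2 - r\<^sup>2) / r" using R by simp_all
  have \<epsilon>: "\<epsilon> * \<epsilon> = 1" "\<bar>\<epsilon>\<bar> = 1" "\<epsilon> \<noteq> 0" using assms(2) by auto
  have b: "b \<noteq> 0" unfolding R'(1) using assms(1) \<epsilon>(3) by simp
  have na: "norm a = norm c / r" unfolding R'(2) using assms(1) \<epsilon>(2) by (simp add: norm_mult norm_divide)
  have "b * b' = (\<epsilon> * \<epsilon>) * (((norm c)\<^sup>2 - r\<^sup>2) / (r * r))" unfolding R' by simp
  also have "\<dots> = (norm a)\<^sup>2 - 1"
    unfolding \<epsilon> na using assms(1) by (simp add: field_simps power2_eq_square)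
  finally have bb: "b * b' = (norm a)\<^sup>2 - 1" .
  have "a / of_real b = c" unfolding R' using assms(1) \<epsilon>(3) by simp
  moreover have "1 / \<bar>b\<bar> = r" unfolding R'(1) using assms(1) \<epsilon>(2) by (simp add: abs_divide)
  ultimately have eq: "circle_eqn b' b a = Some ` sphere c r" using circle_eqn_circle[OF b bb] by simp
  have sgn: "b > 0 \<longleftrightarrow> None \<notin> I" unfolding R'(1) using assms by auto
  show ?L unfolding has_coords_def fst_conv snd_conv if_not_P[OF b] eq using bb sgn by blast
qed

lemma has_coords_line:
  assumes "norm n = 1"
  shows "has_coords (insert None (Some ` {z. n \<bullet> z = k}), Some ` {z. n \<bullet> z > k}) b' b a \<longleftrightarrow>
     b = 0 \<and> a = n \<and> b' = 2 * k" (is "?L \<longleftrightarrow> ?R")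
proof
  assume L: ?L
  have b: "b = 0"
  proof (rule ccontr)
    assume "b \<noteq> 0"
    then have "insert None (Some ` {z. n \<bullet> z = k}) = Some ` sphere (a / of_real b) (1 / \<bar>b\<bar>)"
      using L circle_eqn_circle[of b b' a] by (simp add: has_coords_def)
    then show False by blast
  qed
  have a: "norm a = 1" using L b power2_eq_iff_nonneg[of "norm a" 1] by (simp add: has_coords_def)
  have "insert None (Some ` {z. n \<bullet> z = k}) = insert None (Some ` {z. a \<bullet> z = b' / 2})"
    using L b by (simp add: has_coords_def circle_eqn_line)
  then have l: "n \<bullet> z = k \<longleftrightarrow> a \<bullet> z = b' / 2" for z by (auto simp: set_eq_iff image_iff)
  have aa: "a \<bullet> a = 1" "n \<bullet> n = 1" using a assms by (simp_all add: dot_square_norm)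
  have "a \<bullet> (\<i> * a) = 0" by (simp add: inner_complex_def)
  then have 1: "n \<bullet> ((b'/2) *\<^sub>R a) = k" "n \<bullet> ((b'/2) *\<^sub>R a + \<i> * a) = k"
    unfolding l using aa by (simp_all add: inner_right_distrib)
  then have 2: "n \<bullet> (\<i> * a) = 0" by (simp add: inner_right_distrib)
  have "\<forall>z. n \<bullet> z = k \<longrightarrow> n \<bullet> (z + a) > k" using L b by (auto simp: has_coords_def)
  then have pos: "n \<bullet> a > 0" using 1(1) inner_right_distrib[of n "(b'/2) *\<^sub>R a" a] by (smt (verit))
  have "(n \<bullet> a)\<^sup>2 + (n \<bullet> (\<i> * a))\<^sup>2 = (n \<bullet> n) * (a \<bullet> a)"
    by (simp add: inner_complex_def power2_eq_square algebra_simps)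
  then have "(n \<bullet> a)\<^sup>2 = 1\<^sup>2" using 2 aa by simp
  then have "n \<bullet> a = 1" by (rule power2_eq_imp_eq) (use pos in simp_all)
  then have "(n - a) \<bullet> (n - a) = 0" using aa by (simp add: inner_diff_left inner_diff_right inner_commute)
  then have "a = n" by simp
  then show ?R using b 1(1) aa by simp
next
  assume ?R
  then show ?L using assms by (auto simp: has_coords_def circle_eqn_line inner_right_distrib dot_square_norm)
qed

text \<open>Every oriented circle has unique coordinates, so that \<open>pedoe_vec\<close> is well defined.\<close>

lemma has_coords_unique:
  assumes "C \<in> oriented_circles"
  shows "\<exists>!(b', b, a). has_coords C b' b a"
proof -
  obtain b0' b0 a0 where "\<And>b' b a. has_coords C b' b a \<longleftrightarrow> b = b0 \<and> a = a0 \<and> b' = b0'"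
  proof -
    from assms consider
        c r where "r > 0" "C = (Some ` sphere c r, Some ` ball c r)"
      | c r where "r > 0" "C = (Some ` sphere c r, insert None (Some ` (- cball c r)))"
      | n k where "norm n = 1" "C = (insert None (Some ` {z. n \<bullet> z = k}), Some ` {z. n \<bullet> z > k})"
      unfolding oriented_circles_def by blast
    then show ?thesis
    proof cases
      case (1 c r)
      have N: "None \<in> Some ` ball c r \<longleftrightarrow> (1::real) = -1" by auto
      show ?thesis using that has_coords_circle[OF 1(1) _ N] unfolding 1(2) by blast
    next
      case (2 c r)
      have N: "None \<in> insert None (Some ` (- cball c r)) \<longleftrightarrow> (-1::real) = -1" by auto
      show ?thesis using that has_coords_circle[OF 2(1) _ N] unfolding 2(2) by blast
    next
      case (3 n k)
      show ?thesis using that has_coords_line[OF 3(1)] unfolding 3(2) by blast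
    qed
  qed
  then show ?thesis by (intro ex1I[of _ "(b0', b0, a0)"]) auto
qed

lemma pedoe_vec_eq:
  assumes "C \<in> oriented_circles" "has_coords C b' b a"
  shows "pedoe_vec C = vector [b', b, Re a, Im a]"
proof -
  have "b1' = b' \<and> b1 = b \<and> a1 = a" if "has_coords C b1' b1 a1" for b1' b1 a1
    using has_coords_unique[OF assms(1)] that assms(2) by fastforce
  then show ?thesis unfolding pedoe_vec_def using assms(2) by (intro the_equality) (blast, metis)
qed

definition pedoe :: "real ^ 4 \<Rightarrow> real ^ 4 \<Rightarrow> real" where
  "pedoe v w = - (1/2) * (v$1 * w$2 + v$2 * w$1) + v$3 * w$3 + v$4 * w$4"


section \<open>Bianchi circles\<close>

definition K11 :: "complex set" where
  "K11 = {of_rat x + of_rat y * csqrt (-11) | x y. True}"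

definition O11 :: "complex set" where
  "O11 = {z \<in> K11. algebraic_int z}"

fun moebius_map :: "complex ^ 2 ^ 2 \<Rightarrow> riemann_sphere \<Rightarrow> riemann_sphere" where
  "moebius_map M None = quot (M$1$1) (M$2$1)"
| "moebius_map M (Some z) = quot (M$1$1 * z + M$1$2) (M$2$1 * z + M$2$2)"

text \<open>Elements of the projective group are given by representatives of determinant 1;
  the action does not depend on the sign of the representative.\<close>

definition bianchi_circles :: "riemann_sphere set set" where
  "bianchi_circles = {moebius_map M ` (insert None (Some ` \<real>)) | M.
     (\<forall>i j. M$i$j \<in> O11) \<and> det M = 1}"


section \<open>Tents\<close>

definition tent_gram :: "real list list" where
  "tent_gram =
   [[    1,    -1,  -9/2, -13/2,  -9/2,    -1,  -9/2, -13/2, -13/2,    -1],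
    [   -1,     1,    -1,  -9/2, -13/2,  -9/2, -13/2,  -9/2,   -10,  -9/2],
    [ -9/2,    -1,     1,    -1,  -9/2, -13/2,  -9/2,    -1, -13/2, -13/2],
    [-13/2,  -9/2,    -1,     1,    -1,  -9/2, -13/2,  -9/2,  -9/2,   -10],
    [ -9/2, -13/2,  -9/2,    -1,     1,    -1,  -9/2, -13/2,    -1, -13/2],
    [   -1,  -9/2, -13/2,  -9/2,    -1,     1, -13/2,   -10,  -9/2,  -9/2],
    [ -9/2, -13/2,  -9/2, -13/2,  -9/2, -13/2,     1,    -1,    -1,    -1],
    [-13/2,  -9/2,    -1,  -9/2, -13/2,   -10,    -1,     1,  -9/2,  -9/2],
    [-13/2,   -10, -13/2,  -9/2,    -1,  -9/2,    -1,  -9/2,     1,  -9/2],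
    [   -1,  -9/2, -13/2,   -10, -13/2,  -9/2,    -1,  -9/2,  -9/2,     1]]"

text \<open>The circle \<open>C\<^sub>i\<close> of a tent is \<open>Cs ! (i - 1)\<close>.\<close>

definition is_tent :: "ocircle list \<Rightarrow> bool" where
  "is_tent Cs \<longleftrightarrow> length Cs = 10 \<and>
     (\<forall>C \<in> set Cs. C \<in> oriented_circles \<and> fst C \<in> bianchi_circles) \<and>
     (\<forall>i<10. \<forall>j<10. pedoe (pedoe_vec (Cs ! i)) (pedoe_vec (Cs ! j)) = tent_gram ! i ! j)"

definition belt_labels :: "nat set set" where
  "belt_labels = {{1,2,3,4,5,6}, {1,2,3,8,7,10}, {3,4,5,9,7,8}, {1,6,5,9,7,10}}"

definition tents :: "ocircle set set" where
  "tents = {set Cs | Cs. is_tent Cs}"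

definition belts :: "ocircle set \<Rightarrow> ocircle set set" where
  "belts T = {(\<lambda>i. Cs ! (i - 1)) ` B | Cs B. is_tent Cs \<and> set Cs = T \<and> B \<in> belt_labels}"

definition tent_edges :: "ocircle set set set" where
  "tent_edges = {{S, T} | S T. S \<in> tents \<and> T \<in> tents \<and> S \<noteq> T \<and> belts S \<inter> belts T \<noteq> {}}"


section \<open>Simple graphs, given by their sets of two-element edges\<close>

definition valence :: "'a set set \<Rightarrow> 'a \<Rightarrow> nat" where
  "valence E v = card {e \<in> E. v \<in> e}"

definition is_cycle :: "'a set set \<Rightarrow> 'a list \<Rightarrow> bool" where
  "is_cycle E vs \<longleftrightarrow> length vs \<ge> 3 \<and> distinct vs \<and>
     (\<forall>i < length vs. {vs ! i, vs ! (Suc i mod length vs)} \<in> E)"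

definition is_forest :: "'a set set \<Rightarrow> bool" where
  "is_forest E \<longleftrightarrow> (\<nexists>vs. is_cycle E vs)"


section \<open>Free products of groups\<close>

text \<open>The free product of a family of groups consists of the reduced words: each letter is a
  nontrivial element of one of the groups, and adjacent letters come from different groups.\<close>

definition reduced_words :: "'i set \<Rightarrow> ('i \<Rightarrow> 'a monoid) \<Rightarrow> ('i \<times> 'a) list set" where
  "reduced_words I G = {w. (\<forall>(i, g) \<in> set w. i \<in> I \<and> g \<in> carrier (G i) \<and> g \<noteq> one (G i)) \<and>
     successively (\<lambda>x y. fst x \<noteq> fst y) w}"

fun letter_mult :: "('i \<Rightarrow> 'a monoid) \<Rightarrow> 'i \<times> 'a \<Rightarrow> ('i \<times> 'a) list \<Rightarrow> ('i \<times> 'a) list" where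
  "letter_mult G x [] = [x]"
| "letter_mult G (i, g) ((j, h) # w) =
     (if i \<noteq> j then (i, g) # (j, h) # w
      else if monoid.mult (G i) g h = one (G i) then w
      else (i, monoid.mult (G i) g h) # w)"

definition free_product :: "'i set \<Rightarrow> ('i \<Rightarrow> 'a monoid) \<Rightarrow> ('i \<times> 'a) list monoid" where
  "free_product I G = \<lparr>carrier = reduced_words I G,
     monoid.mult = (\<lambda>u v. foldr (letter_mult G) u v), one = []\<rparr>"


section \<open>The matrix group\<close>

definition GL :: "(real ^ 'n ^ 'n) monoid" where
  "GL = \<lparr>carrier = {A. invertible A}, monoid.mult = (**), one = mat 1\<rparr>"

definition swap_matrices :: "(real ^ 4 ^ 4) list" where
  "swap_matrices =
   [vector [vector [ 1, 3, 3, 3], vector [ 0,-1, 0, 0], vector [ 0, 0,-1, 0], vector [ 0, 0, 0,-1]],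
    vector [vector [-1, 0, 0, 0], vector [ 3, 1, 3, 3], vector [ 0, 0,-1, 0], vector [ 0, 0, 0,-1]],
    vector [vector [-1, 0, 0, 0], vector [ 0,-1, 0, 0], vector [ 3, 3, 1, 3], vector [ 0, 0, 0,-1]],
    vector [vector [-1, 0, 0, 0], vector [ 0,-1, 0, 0], vector [ 0, 0,-1, 0], vector [ 3, 3, 3, 1]]]"

end

theory Submission
  imports Defs
begin

text \<open>The step that depends on the field is that the inversion in \<open>w\<close> respects
  Bianchi circles, and its reason is a congruence. An integer of the field and its conjugate agree
  modulo sqrt(-11), so the vector of a Bianchi circle is, up to sign, that of the real line plus
  sqrt 11 times a lattice vector. Within one sign class all products have the form 1 + 11k/2, which
  excludes -13/2; in a sum of two circles with that product the constant parts therefore cancel, and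
  \<open>w\<close> is sqrt 11 times an integral Hermitian matrix of determinant 1. This is why the
  ring of integers has to be known explicitly. The other constants come from the Gram matrix:
  \<open>w\<close> has self-product 1 + 1 - 13 = -11, two of the four vectors have product -33/2,
  and the inversion -x - (2/11) (x,w) w then becomes 3w - x. Freeness of the matrix group is
  obtained by running the same minimum argument on rows of four numbers, with no reference to a
  particular tent.\<close>

text \<open>A tent is determined by the four vectors \<open>v\<^sub>1 + v\<^sub>4\<close>, \<open>v\<^sub>1 + v\<^sub>8\<close>, \<open>v\<^sub>1 + v\<^sub>9\<close>, \<open>v\<^sub>3 + v\<^sub>9\<close>, which up to
  scaling are the vertices of a regular tetrahedron in hyperbolic space; conversely the tent, as a set,
  determines them as its sums of two vectors of product \<open>-13/2\<close>. Each belt belongs to one of these four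
  vectors \<open>w\<close>, and a tent sharing that belt is either the same tent or its image under the inversion in the
  point \<open>w\<close>, which replaces every other vector \<open>x\<close> of the four by \<open>3 w - x\<close> and maps Bianchi circles to
  Bianchi circles. A positive linear functional with equal values on the four vectors of a tent takes,
  after a nonempty sequence of swaps without backtracking, its strict minimum exactly at the vector fixed
  by the last swap. So the sequence does not return to its start, and a reduced word in the matrices
  determines its last letter.\<close>

section \<open>Pedoe vectors of oriented circles\<close>

lemma pedoe_add_left: "pedoe (u + v) w = pedoe u w + pedoe v w"
  and pedoe_add_right: "pedoe w (u + v) = pedoe w u + pedoe w v"
  and pedoe_diff_left: "pedoe (u - v) w = pedoe u w - pedoe v w"
  and pedoe_diff_right: "pedoe w (u - v) = pedoe w u - pedoe w v"
  and pedoe_minus_left: "pedoe (- u) w = - pedoe u w"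
  and pedoe_minus_right: "pedoe w (- u) = - pedoe w u"
  and pedoe_scaleR_left: "pedoe (c *\<^sub>R u) w = c * pedoe u w"
  and pedoe_scaleR_right: "pedoe w (c *\<^sub>R u) = c * pedoe w u"
  and pedoe_zero_left: "pedoe 0 w = 0"
  and pedoe_zero_right: "pedoe w 0 = 0"
  by (simp_all add: pedoe_def algebra_simps)

lemmas pedoe_linear = pedoe_add_left pedoe_add_right pedoe_diff_left pedoe_diff_right
  pedoe_minus_left pedoe_minus_right pedoe_scaleR_left pedoe_scaleR_right
  pedoe_zero_left pedoe_zero_right

lemma pedoe_commute: "pedoe u v = pedoe v u"
  by (simp add: pedoe_def algebra_simps)

lemma pedoe_sum_left: "pedoe (\<Sum>i\<in>I. f i) w = (\<Sum>i\<in>I. pedoe (f i) w)"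
  by (induction I rule: infinite_finite_induct) (simp_all add: pedoe_linear)

lemma pedoe_sum_right: "pedoe w (\<Sum>i\<in>I. f i) = (\<Sum>i\<in>I. pedoe w (f i))"
  by (induction I rule: infinite_finite_induct) (simp_all add: pedoe_linear)

lemma pedoe_nondegenerate:
  assumes "\<And>w. pedoe v w = 0"
  shows "v = 0"
proof -
  have "v $ 1 = 0" "v $ 2 = 0" "v $ 3 = 0" "v $ 4 = 0"
    using assms[of "axis 2 1"] assms[of "axis 1 1"] assms[of "axis 3 1"] assms[of "axis 4 1"]
    by (simp_all add: pedoe_def axis_def)
  then show ?thesis by (simp add: vec_eq_iff forall_4)
qed

lemma vector_4:
  "(vector [w, x, y, z] :: ('a::zero) ^ 4) $ 1 = w"
  "(vector [w, x, y, z] :: ('a::zero) ^ 4) $ 2 = x"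
  "(vector [w, x, y, z] :: ('a::zero) ^ 4) $ 3 = y"
  "(vector [w, x, y, z] :: ('a::zero) ^ 4) $ 4 = z"
  unfolding vector_def by simp_all

definition normal_coord :: "real ^ 4 \<Rightarrow> complex" where
  "normal_coord v = Complex (v $ 3) (v $ 4)"

text \<open>Inverse of \<open>pedoe_vec\<close> on vectors of self-product 1. For b \<noteq> 0,
  completing the square in the circle equation gives centre a/b and radius 1/|b|, and the sign of b
  selects the side.\<close>

definition circle_of :: "real ^ 4 \<Rightarrow> ocircle" where
  "circle_of v = (let b' = v $ 1; b = v $ 2; a = normal_coord v in
     if b = 0 then (insert None (Some ` {z. a \<bullet> z = b' / 2}), Some ` {z. a \<bullet> z > b' / 2})
     else if b > 0 then (Some ` sphere (a / of_real b) (1 / b), Some ` ball (a / of_real b) (1 / b))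
     else (Some ` sphere (a / of_real b) (- 1 / b), insert None (Some ` (- cball (a / of_real b) (- 1 / b)))))"

lemma normal_coord_vector [simp]: "normal_coord (vector [b', b, Re a, Im a]) = a"
  by (simp add: normal_coord_def vector_4)

lemma pedoe_self: "pedoe v v = (norm (normal_coord v))\<^sup>2 - v $ 2 * v $ 1"
  by (simp only: cmod_power2) (simp add: pedoe_def normal_coord_def algebra_simps power2_eq_square)

lemma vector_coords: "vector [v $ 1, v $ 2, Re (normal_coord v), Im (normal_coord v)] = v"
  by (simp add: vec_eq_iff forall_4 vector_4 normal_coord_def)

lemma circle_of_unit:
  assumes "pedoe v v = 1"
  shows "circle_of v \<in> oriented_circles" "pedoe_vec (circle_of v) = v"
    "fst (circle_of v) = circle_eqn (v $ 1) (v $ 2) (normal_coord v)"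
proof -
  let ?a = "normal_coord v" and ?b = "v $ 2" and ?b' = "v $ 1"
  have bb: "?b * ?b' = (norm ?a)\<^sup>2 - 1" using assms by (simp add: pedoe_self)
  have o: "circle_of v \<in> oriented_circles \<and> has_coords (circle_of v) ?b' ?b ?a"
  proof (cases "?b = 0")
    case True
    then have n: "norm ?a = 1" using bb power2_eq_iff_nonneg[of "norm ?a" 1] by simp
    have c: "circle_of v = (insert None (Some ` {z. ?a \<bullet> z = ?b' / 2}), Some ` {z. ?a \<bullet> z > ?b' / 2})"
      using True by (simp add: circle_of_def Let_def)
    have "circle_of v \<in> oriented_circles" unfolding c oriented_circles_def using n by blast
    moreover have "has_coords (circle_of v) ?b' ?b ?a"
      unfolding c has_coords_line[OF n] using True by simp
    ultimately show ?thesis by blast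
  next
    case False
    have b': "?b' = ((norm ?a)\<^sup>2 - 1) / ?b" using bb False by (simp add: field_simps)
    have sq: "(norm (?a / of_real ?b))\<^sup>2 = (norm ?a)\<^sup>2 / ?b\<^sup>2"
      by (simp add: norm_divide power_divide)
    show ?thesis
    proof (cases "?b > 0")
      case True
      then have r: "1 / ?b > 0" by simp
      have c: "circle_of v = (Some ` sphere (?a / of_real ?b) (1 / ?b), Some ` ball (?a / of_real ?b) (1 / ?b))"
        using True by (simp add: circle_of_def Let_def)
      have N: "None \<in> Some ` ball (?a / of_real ?b) (1 / ?b) \<longleftrightarrow> (1::real) = -1" by auto
      have "circle_of v \<in> oriented_circles" unfolding c oriented_circles_def using r by blast
      moreover have "has_coords (circle_of v) ?b' ?b ?a"
        unfolding c has_coords_circle[OF r disjI1[OF refl] N]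
        unfolding sq b' using True by (simp add: left_diff_distrib right_diff_distrib diff_divide_distrib power2_eq_square)
      ultimately show ?thesis by blast
    next
      case n: False
      then have r: "- 1 / ?b > 0" using False by (simp add: divide_simps)
      have c: "circle_of v = (Some ` sphere (?a / of_real ?b) (- 1 / ?b), insert None (Some ` (- cball (?a / of_real ?b) (- 1 / ?b))))"
        using False n by (simp add: circle_of_def Let_def)
      have N: "None \<in> insert None (Some ` (- cball (?a / of_real ?b) (- 1 / ?b))) \<longleftrightarrow> (-1::real) = -1" by auto
      have "circle_of v \<in> oriented_circles" unfolding c oriented_circles_def using r by blast
      moreover have "has_coords (circle_of v) ?b' ?b ?a"
        unfolding c has_coords_circle[OF r disjI2[OF refl] N]
        unfolding sq b' using False by (simp add: left_diff_distrib right_diff_distrib diff_divide_distrib power2_eq_square)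
      ultimately show ?thesis by blast
    qed
  qed
  then show "circle_of v \<in> oriented_circles" by blast
  show "pedoe_vec (circle_of v) = v"
    using o pedoe_vec_eq vector_coords by metis
  show "fst (circle_of v) = circle_eqn ?b' ?b ?a"
    using o by (simp add: has_coords_def)
qed

lemma circle_of_has_coords:
  assumes "C \<in> oriented_circles" "has_coords C b' b a"
  shows "circle_of (vector [b', b, Re a, Im a]) = C"
proof -
  from assms(1) consider
      c r where "r > 0" "C = (Some ` sphere c r, Some ` ball c r)"
    | c r where "r > 0" "C = (Some ` sphere c r, insert None (Some ` (- cball c r)))"
    | n k where "norm n = 1" "C = (insert None (Some ` {z. n \<bullet> z = k}), Some ` {z. n \<bullet> z > k})"
    unfolding oriented_circles_def by blast
  then show ?thesis
  proof cases
    case (1 c r)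
    have N: "None \<in> Some ` ball c r \<longleftrightarrow> (1::real) = -1" by auto
    have e: "b = 1 / r" "a = of_real (1 / r) * c"
      using has_coords_circle[OF 1(1) disjI1[OF refl] N] assms(2) unfolding 1(2) by simp_all
    show ?thesis unfolding circle_of_def Let_def normal_coord_vector unfolding 1(2) e using 1(1) by (simp add: vector_4)
  next
    case (2 c r)
    have N: "None \<in> insert None (Some ` (- cball c r)) \<longleftrightarrow> (-1::real) = -1" by auto
    have e: "b = -1 / r" "a = of_real (-1 / r) * c"
      using has_coords_circle[OF 2(1) disjI2[OF refl] N] assms(2) unfolding 2(2) by simp_all
    show ?thesis unfolding circle_of_def Let_def normal_coord_vector unfolding 2(2) e using 2(1) by (simp add: vector_4)
  next
    case (3 n k)
    have e: "b = 0" "a = n" "b' = 2 * k"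
      using has_coords_line[OF 3(1)] assms(2) unfolding 3(2) by simp_all
    show ?thesis unfolding circle_of_def Let_def normal_coord_vector unfolding 3(2) e by (simp add: vector_4)
  qed
qed

lemma oriented_circle_coords:
  assumes "C \<in> oriented_circles"
  shows "circle_of (pedoe_vec C) = C" "pedoe (pedoe_vec C) (pedoe_vec C) = 1"
proof -
  obtain b' b a where h: "has_coords C b' b a" using has_coords_unique[OF assms] by auto
  have v: "pedoe_vec C = vector [b', b, Re a, Im a]" by (rule pedoe_vec_eq[OF assms h])
  show "circle_of (pedoe_vec C) = C" unfolding v by (rule circle_of_has_coords[OF assms h])
  show "pedoe (pedoe_vec C) (pedoe_vec C) = 1"
    using h unfolding v pedoe_self by (simp add: has_coords_def vector_4)
qed

lemma circle_eqn_uminus: "circle_eqn (- b') (- b) (- a) = circle_eqn b' b a"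
proof -
  have "of_real (- b) * X * cnj X - (- a) * Y * cnj X - cnj (- a) * X * cnj Y + of_real (- b') * Y * cnj Y
     = - (of_real b * X * cnj X - a * Y * cnj X - cnj a * X * cnj Y + of_real b' * Y * cnj Y)" for X Y
    by simp
  then show ?thesis unfolding circle_eqn_def by (simp only: neg_equal_0_iff_equal)
qed

text \<open>The point set fixes the coordinates only up to a common sign, and the interior chooses
  between the two. For a line the choice is the sign of the inner product of \<open>a\<close> with
  the inward normal \<open>n\<close>.\<close>

lemma circle_eqn_oriented:
  assumes C: "C \<in> oriented_circles" and bb: "b * b' = (norm a)\<^sup>2 - 1" and eq: "fst C = circle_eqn b' b a"
  shows "has_coords C b' b a \<or> has_coords C (- b') (- b) (- a)"
proof (cases "b = 0")
  case False
  then show ?thesis using bb eq by (auto simp: has_coords_def circle_eqn_uminus)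
next
  case True
  have "None \<in> fst C" unfolding eq True circle_eqn_line by simp
  then obtain n k where nk: "norm n = 1" "C = (insert None (Some ` {z. n \<bullet> z = k}), Some ` {z. n \<bullet> z > k})"
    using C unfolding oriented_circles_def by auto
  have "norm a = 1" using bb True power2_eq_iff_nonneg[of "norm a" 1] by simp
  then have aa: "a \<bullet> a = 1" by (simp add: dot_square_norm)
  have "insert None (Some ` {z. n \<bullet> z = k}) = insert None (Some ` {z. a \<bullet> z = b' / 2})"
    using eq unfolding nk True circle_eqn_line by simp
  then have l: "n \<bullet> z = k \<longleftrightarrow> a \<bullet> z = b' / 2" for z by (auto simp: set_eq_iff image_iff)
  \<comment> \<open>If \<open>a\<close> were parallel to the line, moving a point of the line by
    \<open>a\<close> would stay on it by the equation with \<open>n\<close>, yet leave it by the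
    equation with \<open>a\<close>.\<close>
  have "n \<bullet> a \<noteq> 0"
  proof
    assume "n \<bullet> a = 0"
    then have "n \<bullet> ((b' / 2) *\<^sub>R a + a) = n \<bullet> ((b' / 2) *\<^sub>R a)" by (simp add: inner_right_distrib)
    also have "\<dots> = k" unfolding l using aa by simp
    finally have "a \<bullet> ((b' / 2) *\<^sub>R a + a) = b' / 2" unfolding l .
    then show False using aa by (simp add: inner_right_distrib)
  qed
  then consider "n \<bullet> a > 0" | "n \<bullet> a < 0" by linarith
  then show ?thesis
  proof cases
    case 1
    have "\<forall>z. Some z \<in> fst C \<longrightarrow> Some (z + a) \<in> snd C"
      using 1 unfolding nk by (auto simp: inner_right_distrib)
    then have "has_coords C b' b a"
      unfolding has_coords_def using bb eq True by simp
    then show ?thesis ..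
  next
    case 2
    have "fst C = circle_eqn (- b') (- b) (- a)" using eq by (simp only: circle_eqn_uminus)
    moreover have "\<forall>z. Some z \<in> fst C \<longrightarrow> Some (z + - a) \<in> snd C"
      using 2 unfolding nk by (auto simp: inner_diff_right)
    ultimately have "has_coords C (- b') (- b) (- a)"
      unfolding has_coords_def using bb True by simp
    then show ?thesis ..
  qed
qed

section \<open>The ring of integers\<close>

text \<open>In lowest terms the square of the denominator divides 11, which is squarefree.\<close>

lemma rat_mult_11_square_int:
  fixes r :: rat
  assumes "11 * r\<^sup>2 \<in> \<int>"
  shows "r \<in> \<int>"
proof -
  obtain a b where ab: "quotient_of r = (a, b)" by fastforce
  then have b: "b > 0" "coprime a b" and r: "r = of_int a / of_int b"
    using quotient_of_denom_pos quotient_of_coprime quotient_of_div by blast+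
  obtain m where "11 * r\<^sup>2 = of_int m" using assms by (auto elim: Ints_cases)
  then have "(of_int (11 * a\<^sup>2) :: rat) = of_int (m * b\<^sup>2)"
    using b r by (simp add: field_simps)
  then have "11 * a\<^sup>2 = m * b\<^sup>2" by (simp only: of_int_eq_iff)
  then have "b\<^sup>2 dvd 11 * a\<^sup>2" by simp
  moreover have "coprime (b\<^sup>2) (a\<^sup>2)" using b by (simp add: coprime_commute)
  ultimately have d: "b\<^sup>2 dvd 11" by (simp add: coprime_dvd_mult_left_iff)
  have "b = 1"
  proof (rule ccontr)
    assume "b \<noteq> 1"
    then have "b \<ge> 2" using b by simp
    have "b < 4"
    proof (rule ccontr)
      assume "\<not> b < 4"
      then have "4 * 4 \<le> b * b" by (intro mult_mono) auto
      then show False using zdvd_imp_le[OF d] by (simp add: power2_eq_square)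
    qed
    then have "b = 2 \<or> b = 3" using \<open>b \<ge> 2\<close> by auto
    then show False using d by auto
  qed
  then show ?thesis using r by simp
qed

text \<open>By Gauss's lemma the primitive integer multiple of the minimal polynomial of an algebraic
  integer has leading coefficient \<open>\<plusminus>1\<close>.\<close>

lemma quadratic_algebraic_int:
  fixes z :: complex
  assumes z: "algebraic_int z" and im: "Im z \<noteq> 0"
    and t: "2 * Re z \<in> \<rat>" and n: "(norm z)\<^sup>2 \<in> \<rat>"
  shows "2 * Re z \<in> \<int>" "(norm z)\<^sup>2 \<in> \<int>"
proof -
  obtain p1 q1 where pq1: "q1 > 0" "2 * Re z = of_int p1 / of_int q1"
    using t by (auto elim: Rats_cases')
  obtain p2 q2 where pq2: "q2 > 0" "(norm z)\<^sup>2 = of_int p2 / of_int q2"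
    using n by (auto elim: Rats_cases')
  \<comment> \<open>This is X^2 - 2 Re(z) X + |z|^2, the polynomial with roots \<open>z\<close> and
    \<open>cnj z\<close>, with its denominators cleared.\<close>
  define g0 where "g0 = [:p2 * q1, - (p1 * q2), q1 * q2:]"
  define g where "g = primitive_part g0"
  define c where "c = content g0"
  have g0: "g0 \<noteq> 0" "degree g0 = 2" using pq1 pq2 by (auto simp: g0_def)
  have c: "c \<noteq> 0" using g0 by (simp add: c_def)
  have g0g: "g0 = smult c g" by (simp add: g_def c_def)
  have dg: "degree g = 2" using g0 by (simp add: g_def)
  have cg: "content g = 1" using g0 by (simp add: g_def)
  have coeffs: "p2 * q1 = c * coeff g 0" "- (p1 * q2) = c * coeff g 1" "q1 * q2 = c * coeff g 2"
  proof -
    have "coeff g0 i = c * coeff g i" for i unfolding g0g by simp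
    from this[of 0] this[of 1] this[of 2] show "p2 * q1 = c * coeff g 0" "- (p1 * q2) = c * coeff g 1" "q1 * q2 = c * coeff g 2"
      by (simp_all add: g0_def numeral_2_eq_2)
  qed
  have lc: "coeff g 2 \<noteq> 0" using dg by (metis leading_coeff_0_iff degree_0 zero_neq_numeral)
  have rel: "2 * Re z * of_int (coeff g 2) = - of_int (coeff g 1)"
    "(norm z)\<^sup>2 * of_int (coeff g 2) = of_int (coeff g 0)"
  proof -
    have "of_int c * (2 * Re z * of_int (coeff g 2)) = 2 * Re z * of_int (c * coeff g 2)" by simp
    also have "\<dots> = of_int (p1 * q2)" unfolding coeffs(3)[symmetric] pq1(2) using pq1 by simp
    also have "\<dots> = - of_int (c * coeff g 1)" unfolding coeffs(2)[symmetric] by simp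
    finally have "of_int c * (2 * Re z * of_int (coeff g 2)) = of_int c * - of_int (coeff g 1)" by simp
    then show "2 * Re z * of_int (coeff g 2) = - of_int (coeff g 1)"
      using c by (metis mult_cancel_left of_int_eq_0_iff)
    have "of_int c * ((norm z)\<^sup>2 * of_int (coeff g 2)) = (norm z)\<^sup>2 * of_int (c * coeff g 2)" by simp
    also have "\<dots> = of_int (p2 * q1)" unfolding coeffs(3)[symmetric] pq2(2) using pq2 by simp
    also have "\<dots> = of_int c * of_int (coeff g 0)" unfolding coeffs(1) by simp
    finally show "(norm z)\<^sup>2 * of_int (coeff g 2) = of_int (coeff g 0)" using c by simp
  qed
  define ip :: "int poly \<Rightarrow> complex poly" where "ip = map_poly of_int"
  have ip: "ip (p * q) = ip p * ip q" "ip (p + q) = ip p + ip q" for p q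
    unfolding ip_def by (simp_all add: poly_eq_iff coeff_map_poly coeff_mult)
  obtain f where f: "poly (ip f) z = 0" "lead_coeff f = 1"
    using z unfolding algebraic_int_altdef_ipoly ip_def by blast
  have "poly (ip g) z = 0"
  proof -
    have "z\<^sup>2 - of_real (2 * Re z) * z + of_real ((norm z)\<^sup>2) = 0"
      by (simp only: complex_norm_square) (simp add: complex_eq_iff power2_eq_square)
    then have "of_real (of_int (coeff g 2)) * (z\<^sup>2 - of_real (2 * Re z) * z + of_real ((norm z)\<^sup>2)) = 0" by simp
    then have "of_int (coeff g 2) * z\<^sup>2 - of_real (2 * Re z * of_int (coeff g 2)) * z + of_real ((norm z)\<^sup>2 * of_int (coeff g 2)) = 0"
      by (simp add: algebra_simps)
    then have e: "of_int (coeff g 2) * z\<^sup>2 + of_int (coeff g 1) * z + of_int (coeff g 0) = 0"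
      unfolding rel by simp
    have "degree (ip g) = 2" using dg by (simp add: ip_def degree_map_poly)
    then have "poly (ip g) z = (\<Sum>i\<le>2. coeff (ip g) i * z ^ i)" by (simp add: poly_altdef)
    also have "\<dots> = of_int (coeff g 2) * z\<^sup>2 + of_int (coeff g 1) * z + of_int (coeff g 0)"
      by (simp add: numeral_2_eq_2 ip_def coeff_map_poly)
    finally show ?thesis using e by simp
  qed
  \<comment> \<open>Pseudo-division keeps the coefficients integral at the price of a power of the
    leading coefficient of \<open>g\<close>. The remainder is at most linear with integer
    coefficients and vanishes at the nonreal \<open>z\<close>, so it is zero.\<close>
  define k where "k = Suc (degree f) - degree g"
  obtain h r where hr: "pseudo_divmod f g = (h, r)" by fastforce
  have g1: "g \<noteq> 0" using dg by auto
  have psd: "smult (coeff g (degree g) ^ k) f = g * h + r" "r = 0 \<or> degree r < degree g"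
    using pseudo_divmod[OF g1 hr] by (simp_all add: k_def)
  have "r = 0"
  proof (rule ccontr)
    assume "r \<noteq> 0"
    have sm: "ip (smult a p) = smult (of_int a) (ip p)" for a p
      unfolding ip_def by (simp add: poly_eq_iff coeff_map_poly)
    have "poly (ip (smult (coeff g (degree g) ^ k) f)) z = poly (ip (g * h + r)) z"
      unfolding psd(1) ..
    then have "poly (ip r) z = 0" using f \<open>poly (ip g) z = 0\<close> by (simp add: ip sm)
    moreover have "degree r < 2" using psd(2) \<open>r \<noteq> 0\<close> dg by simp
    then obtain r0 r1 where r: "r = [:r0, r1:]"
      by (metis One_nat_def degree1_coeffs less_2_cases_iff less_one degree_0 degree_eq_zeroE linorder_not_less pCons_0_0)
    ultimately have e: "of_int r0 + z * of_int r1 = 0" by (simp add: ip_def map_poly_pCons)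
    then have "Im (of_int r0 + z * of_int r1) = 0" by simp
    then have "r1 = 0" using im by simp
    then have "r0 = 0" using e by simp
    then show False using r \<open>r1 = 0\<close> \<open>r \<noteq> 0\<close> by simp
  qed
  then have fg: "smult (coeff g 2 ^ k) f = g * h" using psd(1) dg by simp
  have cf: "content f = 1"
  proof -
    have "content f dvd coeff f (degree f)" by (rule content_dvd_coeff)
    then show ?thesis unfolding f(2) by (simp only: is_unit_content_iff)
  qed
  \<comment> \<open>Contents are multiplicative and those of \<open>f\<close> and \<open>g\<close>
    are 1, so the power of the leading coefficient divides \<open>h\<close> and cancels. Then
    \<open>g\<close> divides the monic \<open>f\<close> over the integers.\<close>
  have "content (smult (coeff g 2 ^ k) f) = content h" unfolding fg by (simp add: content_mult cg)
  then have "content h = normalize (coeff g 2 ^ k)" by (simp add: cf)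
  then have "coeff g 2 ^ k dvd content h" by simp
  then have "[:coeff g 2 ^ k:] dvd h" by (simp add: const_poly_dvd_iff_dvd_content)
  then obtain h' where h': "h = smult (coeff g 2 ^ k) h'" by (auto elim!: dvdE)
  then have "smult (coeff g 2 ^ k) f = smult (coeff g 2 ^ k) (g * h')" using fg by simp
  then have "f = g * h'" using lc by (auto simp: poly_eq_iff)
  then have "lead_coeff g * lead_coeff h' = 1" using f(2) by (simp add: lead_coeff_mult)
  then have "coeff g 2 dvd 1" unfolding dg by (metis dvd_triv_left)
  then have u: "coeff g 2 = 1 \<or> coeff g 2 = -1" by auto
  then have "2 * Re z = of_int (- coeff g 1) \<or> 2 * Re z = of_int (coeff g 1)"
    using rel(1) by auto
  then show "2 * Re z \<in> \<int>" by (metis Ints_of_int)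
  from u have "(norm z)\<^sup>2 = of_int (coeff g 0) \<or> (norm z)\<^sup>2 = of_int (- coeff g 0)"
    using rel(2) by auto
  then show "(norm z)\<^sup>2 \<in> \<int>" by (metis Ints_of_int)
qed

lemma csqrt_minus_11: "csqrt (- 11) = Complex 0 (sqrt 11)"
proof -
  have "csqrt (- 11) = csqrt (- of_real 11)" by simp
  also have "\<dots> = \<i> * csqrt (of_real 11)" by (rule csqrt_minus) simp
  also have "\<dots> = \<i> * of_real (sqrt 11)" by (subst of_real_sqrt) simp_all
  finally show ?thesis by (simp add: complex_eq_iff)
qed

text \<open>Since -11 is 1 modulo 4, half-integers of equal parity occur. Trace and norm being
  integral gives x = 2p and, as 11 (2q)^2 is integral, y = 2q; the norm equation 4n = x^2 + 11 y^2
  then forces the parity.\<close>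

lemma O11_iff:
  "z \<in> O11 \<longleftrightarrow> (\<exists>x y :: int. even (x + y) \<and> z = Complex (of_int x / 2) (of_int y / 2 * sqrt 11))"
proof
  assume "z \<in> O11"
  then obtain p q where pq: "z = of_rat p + of_rat q * csqrt (- 11)" and ai: "algebraic_int z"
    unfolding O11_def K11_def by blast
  have cr: "complex_of_rat a = of_real (of_rat a)" for a
    by (cases a) (simp add: of_rat_rat)
  have re: "Re z = of_rat p" and im: "Im z = of_rat q * sqrt 11"
    unfolding pq csqrt_minus_11 cr by simp_all
  have nz: "(norm z)\<^sup>2 = of_rat (p\<^sup>2 + 11 * q\<^sup>2)"
    by (simp only: cmod_power2) (simp add: re im of_rat_add of_rat_mult of_rat_power power_mult_distrib)
  show "\<exists>x y :: int. even (x + y) \<and> z = Complex (of_int x / 2) (of_int y / 2 * sqrt 11)"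
  proof (cases "q = 0")
    case True
    then have "z \<in> \<rat>" using pq by simp
    then have "z \<in> \<int>" using rational_algebraic_int_is_int ai by blast
    then obtain m where "z = of_int m" by (auto elim: Ints_cases)
    then have "even (2 * m + 0) \<and> z = Complex (of_int (2 * m) / 2) (of_int 0 / 2 * sqrt 11)"
      by (simp add: complex_eq_iff)
    then show ?thesis by blast
  next
    case False
    have "2 * Re z = of_rat (2 * p)" by (simp add: re of_rat_mult)
    then have r: "2 * Re z \<in> \<rat>" "(norm z)\<^sup>2 \<in> \<rat>" unfolding nz by simp_all
    have i0: "Im z \<noteq> 0" using False im by simp
    obtain x where x: "2 * Re z = of_int x"
      using quadratic_algebraic_int(1)[OF ai i0 r] by (auto elim: Ints_cases)
    obtain n where n: "(norm z)\<^sup>2 = of_int n"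
      using quadratic_algebraic_int(2)[OF ai i0 r] by (auto elim: Ints_cases)
    have px: "2 * p = of_int x"
    proof -
      have "(of_rat (2 * p) :: real) = of_rat (of_int x)" using x re by (simp add: of_rat_mult)
      then show ?thesis by (simp only: of_rat_eq_iff)
    qed
    have pn: "p\<^sup>2 + 11 * q\<^sup>2 = of_int n"
    proof -
      have "(of_rat (p\<^sup>2 + 11 * q\<^sup>2) :: real) = of_rat (of_int n)" using n unfolding nz by simp
      then show ?thesis by (simp only: of_rat_eq_iff)
    qed
    have e: "(of_int x)\<^sup>2 + 11 * (2 * q)\<^sup>2 = (of_int (4 * n) :: rat)"
      unfolding px[symmetric] of_int_mult pn[symmetric] by (simp add: power2_eq_square algebra_simps)
    then have "11 * (2 * q)\<^sup>2 = of_int (4 * n - x\<^sup>2)" by simp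
    then have "2 * q \<in> \<int>" by (metis rat_mult_11_square_int Ints_of_int)
    then obtain y where y: "2 * q = of_int y" by (auto elim: Ints_cases)
    have "(of_int (x\<^sup>2 + 11 * y\<^sup>2) :: rat) = of_int (4 * n)" using e unfolding y by simp
    then have "x\<^sup>2 + 11 * y\<^sup>2 = 4 * n" by (simp only: of_int_eq_iff)
    then have "even (x\<^sup>2 + 11 * y\<^sup>2)" by simp
    then have "even (x + y)" by (simp add: power2_eq_square)
    moreover have "Im z = of_int y / 2 * sqrt 11"
    proof -
      have "(of_rat (2 * q) :: real) = of_int y" unfolding y by simp
      then show ?thesis using im by (simp add: of_rat_mult)
    qed
    then have "z = Complex (of_int x / 2) (of_int y / 2 * sqrt 11)" using x by (simp add: complex_eq_iff)
    ultimately show ?thesis by blast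
  qed
next
  assume "\<exists>x y :: int. even (x + y) \<and> z = Complex (of_int x / 2) (of_int y / 2 * sqrt 11)"
  then obtain x y :: int where ev: "even (x + y)" and z: "z = Complex (of_int x / 2) (of_int y / 2 * sqrt 11)"
    by blast
  have "z = of_rat (of_int x / 2) + of_rat (of_int y / 2) * csqrt (- 11)"
    unfolding csqrt_minus_11 z by (simp add: complex_eq_iff of_rat_divide)
  then have K: "z \<in> K11" unfolding K11_def by blast
  \<comment> \<open>In the basis 1, \<omega> = (-1 + sqrt(-11))/2 the number is k + y \<omega>, and
    \<open>n\<close> below is its norm, because \<omega>^2 + \<omega> + 3 = 0.\<close>
  obtain k where k: "x = 2 * k - y" using ev by (metis add_diff_cancel_right' dvdE)
  define n where "n = k\<^sup>2 - k * y + 3 * y\<^sup>2"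
  have n4: "4 * n = x\<^sup>2 + 11 * y\<^sup>2" by (simp add: n_def k power2_eq_square algebra_simps)
  have "z\<^sup>2 - of_int x * z + of_int n = 0"
  proof -
    have "4 * real_of_int n = (of_int x)\<^sup>2 + 11 * (of_int y)\<^sup>2"
      using arg_cong[OF n4, of real_of_int] by simp
    then have "real_of_int n = ((of_int x)\<^sup>2 + 11 * (of_int y)\<^sup>2) / 4" by simp
    moreover have "sqrt 11 * sqrt 11 = 11" by simp
    ultimately show ?thesis
      by (simp add: z complex_eq_iff power2_eq_square algebra_simps)
  qed
  then have "poly [:of_int n, - of_int x, 1:] z = 0" by (simp add: power2_eq_square algebra_simps)
  then have "algebraic_int z"
    by (intro algebraic_int.intros[of "[:of_int n, - of_int x, 1:]"]) (auto simp: coeff_pCons split: nat.splits)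
  then show "z \<in> O11" using K by (simp add: O11_def)
qed

section \<open>Closure properties of the ring of integers\<close>

lemma of_int_in_O11: "of_int n \<in> O11"
  unfolding O11_iff by (intro exI[of _ "2 * n"] exI[of _ 0]) (simp add: complex_eq_iff)

lemma O11_add: assumes "u \<in> O11" "v \<in> O11" shows "u + v \<in> O11"
proof -
  obtain x y x' y' :: int where "even (x + y)" "u = Complex (of_int x / 2) (of_int y / 2 * sqrt 11)"
    "even (x' + y')" "v = Complex (of_int x' / 2) (of_int y' / 2 * sqrt 11)"
    using assms unfolding O11_iff by blast
  then show ?thesis unfolding O11_iff
    by (intro exI[of _ "x + x'"] exI[of _ "y + y'"]) (auto simp: complex_eq_iff field_simps)
qed

lemma O11_uminus: assumes "u \<in> O11" shows "- u \<in> O11"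
proof -
  obtain x y :: int where "even (x + y)" "u = Complex (of_int x / 2) (of_int y / 2 * sqrt 11)"
    using assms unfolding O11_iff by blast
  then show ?thesis unfolding O11_iff
    by (intro exI[of _ "- x"] exI[of _ "- y"]) (auto simp: complex_eq_iff)
qed

lemma O11_diff: assumes "u \<in> O11" "v \<in> O11" shows "u - v \<in> O11"
  using O11_add[OF assms(1) O11_uminus[OF assms(2)]] by simp

lemma O11_cnj: assumes "u \<in> O11" shows "cnj u \<in> O11"
proof -
  obtain x y :: int where "even (x + y)" "u = Complex (of_int x / 2) (of_int y / 2 * sqrt 11)"
    using assms unfolding O11_iff by blast
  then show ?thesis unfolding O11_iff
    by (intro exI[of _ x] exI[of _ "- y"]) (auto simp: complex_eq_iff)
qed

lemma O11_mult: assumes "u \<in> O11" "v \<in> O11" shows "u * v \<in> O11"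
proof -
  obtain x y x' y' :: int where xy: "even (x + y)" "u = Complex (of_int x / 2) (of_int y / 2 * sqrt 11)"
    "even (x' + y')" "v = Complex (of_int x' / 2) (of_int y' / 2 * sqrt 11)"
    using assms unfolding O11_iff by blast
  obtain k k' where k: "x = 2 * k - y" "x' = 2 * k' - y'"
    using xy(1,3) by (metis add_diff_cancel_right' dvdE)
  have "sqrt 11 * (sqrt 11 * c) = 11 * c" for c by (simp flip: mult.assoc)
  \<comment> \<open>With \<omega>^2 = -\<omega> - 3 the product of k + y \<omega> and k' + y'
    \<omega> is (k k' - 3 y y') + (k y' + k' y - y y') \<omega>; the witnesses are these
    coefficients converted back to x = 2k - y.\<close>
  then show ?thesis unfolding O11_iff
    by (intro exI[of _ "2 * k * k' - k * y' - k' * y - 5 * y * y'"] exI[of _ "k * y' + k' * y - y * y'"])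
       (auto simp: xy complex_eq_iff k field_simps)
qed

lemma Im_O11: assumes "u \<in> O11" shows "2 * Im u / sqrt 11 \<in> \<int>"
  using assms unfolding O11_iff by auto

section \<open>Bianchi circles\<close>

text \<open>Coefficients of the Hermitian form i (t cnj s - cnj t s), whose zeros are the extended
  real line, after the substitution of the inverse of \<open>M\<close> (for determinant 1). The
  identity matrix gives \<open>axis 4 1\<close>, the upper half-plane.\<close>

definition form_vec :: "complex ^ 2 ^ 2 \<Rightarrow> real ^ 4" where
  "form_vec M = (let w = M$1$1 * cnj (M$2$2) - M$1$2 * cnj (M$2$1) in
     vector [- 2 * Im (M$1$1 * cnj (M$1$2)), - 2 * Im (M$2$1 * cnj (M$2$2)), - Im w, Re w])"

lemma form_vec_coords:
  "complex_of_real (form_vec M $ 1) = \<i> * (M$1$1 * cnj (M$1$2) - cnj (M$1$1) * M$1$2)"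
  "complex_of_real (form_vec M $ 2) = \<i> * (M$2$1 * cnj (M$2$2) - cnj (M$2$1) * M$2$2)"
  "normal_coord (form_vec M) = \<i> * (M$1$1 * cnj (M$2$2) - M$1$2 * cnj (M$2$1))"
  by (simp_all add: form_vec_def Let_def vector_4 normal_coord_def complex_eq_iff)

lemma complex_of_real_pedoe:
  "complex_of_real (2 * pedoe u v) = - (of_real (u$1) * of_real (v$2) + of_real (u$2) * of_real (v$1)) +
     (normal_coord u * cnj (normal_coord v) + cnj (normal_coord u) * normal_coord v)"
  by (simp add: pedoe_def normal_coord_def complex_eq_iff algebra_simps)

text \<open>The self-product is minus the determinant of the Hermitian form, and a change of
  variables multiplies that determinant by the squared modulus of the determinant of the
  substitution.\<close>

lemma pedoe_form_vec:
  assumes "det M = 1"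
  shows "pedoe (form_vec M) (form_vec M) = 1"
proof -
  have "complex_of_real (2 * pedoe (form_vec M) (form_vec M)) = 2 * (det M * cnj (det M))"
    unfolding complex_of_real_pedoe form_vec_coords det_2
    by (simp add: algebra_simps)
  also have "\<dots> = of_real 2" using assms by simp
  finally show ?thesis by (simp only: of_real_eq_iff)
qed

text \<open>In homogeneous coordinates \<open>T\<close> and \<open>S\<close> are the components of
  the inverse of \<open>M\<close> applied to (X, Y), and the circle equation says that T cnj S is
  real, that is, that T/S lies on the extended real line.\<close>

lemma moebius_image_eq_circle_eqn:
  assumes "det M = 1"
  shows "moebius_map M ` insert None (Some ` \<real>) =
    circle_eqn (form_vec M $ 1) (form_vec M $ 2) (normal_coord (form_vec M))"
proof -
  obtain \<alpha> \<beta> \<gamma> \<delta> where M: "M$1$1 = \<alpha>" "M$1$2 = \<gamma>" "M$2$1 = \<beta>" "M$2$2 = \<delta>" by blast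
  have d: "\<alpha> * \<delta> - \<gamma> * \<beta> = 1" using assms by (simp add: det_2 M)
  define T where "T = (\<lambda>X Y. \<delta> * X - \<gamma> * Y)"
  define S where "S = (\<lambda>X Y. \<alpha> * Y - \<beta> * X)"
  let ?b' = "form_vec M $ 1" and ?b = "form_vec M $ 2" and ?a = "normal_coord (form_vec M)"
  have form: "of_real ?b * X * cnj X - ?a * Y * cnj X - cnj ?a * X * cnj Y + of_real ?b' * Y * cnj Y
      = \<i> * (T X Y * cnj (S X Y) - cnj (T X Y) * S X Y)" for X Y
    unfolding form_vec_coords M T_def S_def by (simp add: algebra_simps)
  have inv: "X = \<alpha> * T X Y + \<gamma> * S X Y" "Y = \<beta> * T X Y + \<delta> * S X Y" for X Y
  proof -
    have "\<alpha> * T X Y + \<gamma> * S X Y = (\<alpha> * \<delta> - \<gamma> * \<beta>) * X" "\<beta> * T X Y + \<delta> * S X Y = (\<alpha> * \<delta> - \<gamma> * \<beta>) * Y"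
      by (simp_all add: T_def S_def algebra_simps)
    then show "X = \<alpha> * T X Y + \<gamma> * S X Y" "Y = \<beta> * T X Y + \<delta> * S X Y" by (simp_all add: d)
  qed
  have TS: "T (\<alpha> * t + \<gamma> * s) (\<beta> * t + \<delta> * s) = t" "S (\<alpha> * t + \<gamma> * s) (\<beta> * t + \<delta> * s) = s" for t s
  proof -
    have "T (\<alpha> * t + \<gamma> * s) (\<beta> * t + \<delta> * s) = (\<alpha> * \<delta> - \<gamma> * \<beta>) * t"
      "S (\<alpha> * t + \<gamma> * s) (\<beta> * t + \<delta> * s) = (\<alpha> * \<delta> - \<gamma> * \<beta>) * s"
      by (simp_all add: T_def S_def algebra_simps)
    then show "T (\<alpha> * t + \<gamma> * s) (\<beta> * t + \<delta> * s) = t" "S (\<alpha> * t + \<gamma> * s) (\<beta> * t + \<delta> * s) = s"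
      by (simp_all add: d)
  qed
  have circle: "quot (\<alpha> * t + \<gamma> * s) (\<beta> * t + \<delta> * s) \<in> circle_eqn ?b' ?b ?a"
    if "(t, s) \<noteq> (0, 0)" "t * cnj s = cnj t * s" for t s
  proof -
    have "(\<alpha> * t + \<gamma> * s, \<beta> * t + \<delta> * s) \<noteq> (0, 0)"
      using TS[of t s] that(1) by (auto simp: T_def S_def)
    then show ?thesis unfolding circle_eqn_def form mem_Collect_eq
      using that(2) by (intro exI[of _ "\<alpha> * t + \<gamma> * s"] exI[of _ "\<beta> * t + \<delta> * s"]) (simp only: TS, simp)
  qed
  show ?thesis
  proof (intro equalityI subsetI)
    fix p assume "p \<in> moebius_map M ` insert None (Some ` \<real>)"
    then consider "p = moebius_map M None" | r where "r \<in> \<real>" "p = moebius_map M (Some r)" by blast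
    then show "p \<in> circle_eqn ?b' ?b ?a"
    proof cases
      case 1
      then show ?thesis using circle[of 1 0] by (simp add: M)
    next
      case 2
      then show ?thesis using circle[of r 1] by (simp add: M Reals_cnj_iff)
    qed
  next
    fix p assume "p \<in> circle_eqn ?b' ?b ?a"
    then obtain X Y where XY: "p = quot X Y" "(X, Y) \<noteq> (0, 0)" "T X Y * cnj (S X Y) = cnj (T X Y) * S X Y"
      unfolding circle_eqn_def form by auto
    define t s where "t = T X Y" and "s = S X Y"
    have ts: "X = \<alpha> * t + \<gamma> * s" "Y = \<beta> * t + \<delta> * s" "t * cnj s = cnj t * s"
      using inv XY(3) by (simp_all add: t_def s_def)
    show "p \<in> moebius_map M ` insert None (Some ` \<real>)"
    proof (cases "s = 0")
      case True
      then have "t \<noteq> 0" using XY(2) ts by auto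
      then have "p = moebius_map M None" using True ts XY(1) by (simp add: M quot_def)
      then show ?thesis by blast
    next
      case False
      have "cnj (t / s) = t / s" using ts(3) False by (simp add: field_simps)
      then have "t / s \<in> \<real>" by (simp add: Reals_cnj_iff)
      moreover have "X = s * (\<alpha> * (t / s) + \<gamma>)" "Y = s * (\<beta> * (t / s) + \<delta>)"
        using ts False by (simp_all add: field_simps)
      then have "p = moebius_map M (Some (t / s))" unfolding XY(1) using False by (simp add: M quot_def)
      ultimately show ?thesis by blast
    qed
  qed
qed

definition bianchi_vecs :: "(real ^ 4) set" where
  "bianchi_vecs = {v. \<exists>M. (\<forall>i j. M$i$j \<in> O11) \<and> det M = 1 \<and> (v = form_vec M \<or> v = - form_vec M)}"

lemma bianchi_vecs_unit: "v \<in> bianchi_vecs \<Longrightarrow> pedoe v v = 1"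
  by (auto simp: bianchi_vecs_def pedoe_form_vec pedoe_linear)

lemma normal_coord_linear:
  "normal_coord (u + v) = normal_coord u + normal_coord v"
  "normal_coord (u - v) = normal_coord u - normal_coord v"
  "normal_coord (- v) = - normal_coord v"
  "normal_coord (c *\<^sub>R v) = of_real c * normal_coord v"
  by (simp_all add: normal_coord_def complex_eq_iff)

lemma bianchi_circle_iff:
  assumes C: "C \<in> oriented_circles"
  shows "fst C \<in> bianchi_circles \<longleftrightarrow> pedoe_vec C \<in> bianchi_vecs"
proof
  assume "fst C \<in> bianchi_circles"
  then obtain M where M: "\<forall>i j. M$i$j \<in> O11" "det M = 1" "fst C = moebius_map M ` insert None (Some ` \<real>)"
    unfolding bianchi_circles_def by blast
  let ?v = "form_vec M"
  have eq: "fst C = circle_eqn (?v $ 1) (?v $ 2) (normal_coord ?v)"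
    unfolding M(3) by (rule moebius_image_eq_circle_eqn[OF M(2)])
  have "?v $ 2 * ?v $ 1 = (norm (normal_coord ?v))\<^sup>2 - 1"
    using pedoe_form_vec[OF M(2)] pedoe_self[of ?v] by simp
  from circle_eqn_oriented[OF C this eq]
  have "pedoe_vec C = ?v \<or> pedoe_vec C = - ?v"
  proof
    assume "has_coords C (?v $ 1) (?v $ 2) (normal_coord ?v)"
    then have "pedoe_vec C = ?v" using pedoe_vec_eq[OF C] by (simp add: vector_coords)
    then show ?thesis ..
  next
    assume "has_coords C (- ?v $ 1) (- ?v $ 2) (- normal_coord ?v)"
    then have "pedoe_vec C = - ?v"
      using pedoe_vec_eq[OF C] vector_coords[of "- ?v"] by (simp add: normal_coord_linear)
    then show ?thesis ..
  qed
  then show "pedoe_vec C \<in> bianchi_vecs" unfolding bianchi_vecs_def using M by blast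
next
  let ?v = "pedoe_vec C"
  assume "?v \<in> bianchi_vecs"
  then obtain M where M: "\<forall>i j. M$i$j \<in> O11" "det M = 1" "?v = form_vec M \<or> ?v = - form_vec M"
    unfolding bianchi_vecs_def by blast
  have "fst C = circle_eqn (?v $ 1) (?v $ 2) (normal_coord ?v)"
    using circle_of_unit(3)[OF oriented_circle_coords(2)[OF C]] oriented_circle_coords(1)[OF C] by simp
  also have "\<dots> = circle_eqn (form_vec M $ 1) (form_vec M $ 2) (normal_coord (form_vec M))"
    using M(3) by (auto simp: normal_coord_linear circle_eqn_uminus)
  also have "\<dots> = moebius_map M ` insert None (Some ` \<real>)"
    by (rule moebius_image_eq_circle_eqn[OF M(2), symmetric])
  finally show "fst C \<in> bianchi_circles" unfolding bianchi_circles_def using M by blast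
qed

section \<open>The lattice of Bianchi circle coordinates and its inversions\<close>

definition lattice_vec :: "int \<Rightarrow> int \<Rightarrow> complex \<Rightarrow> real ^ 4" where
  "lattice_vec m n l = vector [of_int m, of_int n, Re l, Im l]"

lemma lattice_vec_coords:
  "lattice_vec m n l $ 1 = of_int m" "lattice_vec m n l $ 2 = of_int n" "normal_coord (lattice_vec m n l) = l"
  by (simp_all add: lattice_vec_def vector_4)

lemma vec4_eqI:
  assumes "u $ 1 = v $ 1" "u $ 2 = v $ 2" "normal_coord u = normal_coord v"
  shows "u = v"
  using assms vector_coords[of u] vector_coords[of v] by metis

text \<open>Conjugation changes an element of the ring by an integer multiple of sqrt(-11). Removing
  the conjugates from the second row turns the mixed term of the form into the determinant 1 plus
  sqrt(-11) times an element of the ring.\<close>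

lemma form_vec_lattice:
  assumes M: "\<forall>i j. M$i$j \<in> O11" "det M = 1"
  obtains m n l where "l \<in> O11" "form_vec M = axis 4 1 + sqrt 11 *\<^sub>R lattice_vec m n l"
proof -
  have O: "M$i$j \<in> O11" for i j using M(1) by blast
  obtain m where m: "2 * Im (M$1$1 * cnj (M$1$2)) / sqrt 11 = of_int m"
    using Im_O11[OF O11_mult[OF O[of 1 1] O11_cnj[OF O[of 1 2]]]] by (rule Ints_cases)
  obtain n where n: "2 * Im (M$2$1 * cnj (M$2$2)) / sqrt 11 = of_int n"
    using Im_O11[OF O11_mult[OF O[of 2 1] O11_cnj[OF O[of 2 2]]]] by (rule Ints_cases)
  obtain y where y: "2 * Im (M$2$2) / sqrt 11 = of_int y" using Im_O11[OF O] by (rule Ints_cases)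
  obtain x where x: "2 * Im (M$2$1) / sqrt 11 = of_int x" using Im_O11[OF O] by (rule Ints_cases)
  define l where "l = M$1$1 * of_int y - M$1$2 * of_int x"
  have l: "l \<in> O11" unfolding l_def by (intro O11_diff O11_mult O of_int_in_O11)
  have c: "cnj (M$2$2) = M$2$2 - \<i> * of_real (sqrt 11) * of_int y" "cnj (M$2$1) = M$2$1 - \<i> * of_real (sqrt 11) * of_int x"
    using y x by (simp_all add: complex_eq_iff field_simps)
  have "form_vec M = axis 4 1 + sqrt 11 *\<^sub>R lattice_vec (- m) (- n) l"
  proof (rule vec4_eqI)
    have "normal_coord (form_vec M) = \<i> * (det M - \<i> * of_real (sqrt 11) * l)"
      unfolding form_vec_coords c det_2 l_def by (simp add: algebra_simps)
    also have "\<dots> = \<i> + of_real (sqrt 11) * l" unfolding M(2) by (simp add: algebra_simps)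
    also have "\<i> = normal_coord (axis 4 1)" by (simp add: normal_coord_def axis_def complex_eq_iff)
    finally show "normal_coord (form_vec M) = normal_coord (axis 4 1 + sqrt 11 *\<^sub>R lattice_vec (- m) (- n) l)"
      by (simp add: normal_coord_linear lattice_vec_coords)
  qed (use m n in \<open>simp_all add: form_vec_def Let_def vector_4 lattice_vec_coords axis_def field_simps\<close>)
  with l show ?thesis by (rule that)
qed

lemma pedoe_lattice:
  assumes "l \<in> O11" "l' \<in> O11"
  obtains k where "pedoe (axis 4 1 + sqrt 11 *\<^sub>R lattice_vec m n l) (axis 4 1 + sqrt 11 *\<^sub>R lattice_vec m' n' l') = 1 + 11 / 2 * of_int k"
proof -
  obtain x y x' y' :: int where xy: "even (x + y)" "l = Complex (of_int x / 2) (of_int y / 2 * sqrt 11)"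
    "even (x' + y')" "l' = Complex (of_int x' / 2) (of_int y' / 2 * sqrt 11)"
    using assms unfolding O11_iff by blast
  obtain k k' where k: "x = 2 * k - y" "x' = 2 * k' - y'"
    using xy(1,3) by (metis add_diff_cancel_right' dvdE)
  have s: "sqrt 11 * (sqrt 11 * c) = 11 * c" for c by (simp flip: mult.assoc)
  \<comment> \<open>The single terms y and y' come from pairing with \<open>axis 4 1\<close>. The
    terms with two of k, k', y, y' form the trace of l cnj l', computed with l = k + y \<omega> and
    l' = k' + y' \<omega>.\<close>
  have "pedoe (axis 4 1 + sqrt 11 *\<^sub>R lattice_vec m n l) (axis 4 1 + sqrt 11 *\<^sub>R lattice_vec m' n' l')
     = 1 + 11 / 2 * of_int (- (m * n' + n * m') + y + y' + 2 * k * k' - k * y' - k' * y + 6 * y * y')"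
    by (simp add: pedoe_def lattice_vec_def vector_4 axis_def xy k algebra_simps s) (simp add: field_simps)
  then show ?thesis by (rule that)
qed

text \<open>Only circles of opposite orientation class can have product \<open>-13/2\<close>, so the constant parts
  \<open>\<plusminus>\<i>\<close> of their normal coordinates cancel in the sum.\<close>

lemma bianchi_sum_lattice:
  assumes "u \<in> bianchi_vecs" "v \<in> bianchi_vecs" "pedoe u v = -13/2"
  obtains m n l where "l \<in> O11" "u + v = sqrt 11 *\<^sub>R lattice_vec m n l"
proof -
  have ex: "\<exists>m n l. l \<in> O11 \<and> (v = axis 4 1 + sqrt 11 *\<^sub>R lattice_vec m n l \<or> v = - (axis 4 1 + sqrt 11 *\<^sub>R lattice_vec m n l))"
    if v: "v \<in> bianchi_vecs" for v
  proof -
    obtain M where M: "\<forall>i j. M$i$j \<in> O11" "det M = 1" "v = form_vec M \<or> v = - form_vec M"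
      using v unfolding bianchi_vecs_def by blast
    obtain m n l where "l \<in> O11" "form_vec M = axis 4 1 + sqrt 11 *\<^sub>R lattice_vec m n l"
      using form_vec_lattice[OF M(1,2)] by blast
    with M(3) show ?thesis by metis
  qed
  let ?f = "\<lambda>m n l. axis 4 1 + sqrt 11 *\<^sub>R lattice_vec m n l"
  obtain m n l where u: "l \<in> O11" "u = ?f m n l \<or> u = - ?f m n l" using ex[OF assms(1)] by blast
  obtain m' n' l' where v: "l' \<in> O11" "v = ?f m' n' l' \<or> v = - ?f m' n' l'" using ex[OF assms(2)] by blast
  obtain k where k: "pedoe (?f m n l) (?f m' n' l') = 1 + 11 / 2 * of_int k" using pedoe_lattice[OF u(1) v(1)] .
  have ne: "1 + 11 / 2 * of_int k \<noteq> (-13/2 :: real)"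
  proof
    assume "1 + 11 / 2 * of_int k = (-13/2 :: real)"
    then have "of_int (11 * k) = (of_int (-15) :: real)" by simp
    then have "11 * k = -15" by (simp only: of_int_eq_iff)
    then show False by presburger
  qed
  have d: "?f m n l - ?f m' n' l' = sqrt 11 *\<^sub>R lattice_vec (m - m') (n - n') (l - l')"
    "?f m' n' l' - ?f m n l = sqrt 11 *\<^sub>R lattice_vec (m' - m) (n' - n) (l' - l)"
    by (simp_all add: vec_eq_iff forall_4 lattice_vec_def vector_4 algebra_simps)
  consider "u = ?f m n l" "v = - ?f m' n' l'" | "u = - ?f m n l" "v = ?f m' n' l'"
    | "pedoe u v = 1 + 11 / 2 * of_int k"
    using u(2) v(2) k by (metis pedoe_minus_left pedoe_minus_right minus_minus)
  then show ?thesis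
  proof cases
    case 1
    then have "u + v = ?f m n l - ?f m' n' l'" by simp
    then show ?thesis unfolding d by (rule that[OF O11_diff[OF u(1) v(1)]])
  next
    case 2
    then have "u + v = ?f m' n' l' - ?f m n l" by simp
    then show ?thesis unfolding d by (rule that[OF O11_diff[OF v(1) u(1)]])
  next
    case 3
    then show ?thesis using assms(3) ne by simp
  qed
qed

text \<open>The inversion in the point of hyperbolic space given by \<open>w = u + v\<close> preserves Bianchi circles:
  after scaling, \<open>w\<close> is the matrix of the antiholomorphic involution
  \<open>z \<mapsto> (l * cnj z - m) / (n * cnj z - cnj l)\<close> with coefficients in the ring of integers.\<close>

lemma bianchi_inversion:
  assumes uv: "u \<in> bianchi_vecs" "v \<in> bianchi_vecs" "pedoe u v = -13/2" and z: "z \<in> bianchi_vecs"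
  shows "- z - (2/11 * pedoe z (u + v)) *\<^sub>R (u + v) \<in> bianchi_vecs"
proof -
  obtain m n l where l: "l \<in> O11" and w: "u + v = sqrt 11 *\<^sub>R lattice_vec m n l"
    using bianchi_sum_lattice[OF uv] .
  define q where "q = lattice_vec m n l"
  have "pedoe (u + v) (u + v) = -11"
    using uv by (simp add: pedoe_linear bianchi_vecs_unit pedoe_commute[of v u])
  moreover have "pedoe (u + v) (u + v) = 11 * pedoe q q"
    unfolding w q_def pedoe_scaleR_left pedoe_scaleR_right by (simp flip: mult.assoc)
  ultimately have q: "pedoe q q = -1" by simp
  have det1: "of_int m * of_int n - l * cnj l = 1"
  proof -
    have "complex_of_real (2 * pedoe q q) = -2" by (simp add: q)
    then have "2 * (of_int m * of_int n - l * cnj l) = 2"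
      unfolding complex_of_real_pedoe q_def lattice_vec_coords by (simp add: algebra_simps)
    then show ?thesis by (metis mult_cancel_left2 zero_neq_numeral)
  qed
  obtain M where M: "\<forall>i j. M$i$j \<in> O11" "det M = 1" "z = form_vec M \<or> z = - form_vec M"
    using z unfolding bianchi_vecs_def by blast
  have O: "M$i$j \<in> O11" for i j using M(1) by blast
  \<comment> \<open>\<open>N\<close> is the matrix with rows (l, -m) and (n, -cnj l), of determinant
    1 by \<open>det1\<close>, times the conjugate of \<open>M\<close>: the antiholomorphic
    involution composed with \<open>M\<close>, which on the real line agrees with a holomorphic
    map.\<close>
  define N :: "complex ^ 2 ^ 2" where "N = vector
    [vector [l * cnj (M$1$1) - of_int m * cnj (M$2$1), l * cnj (M$1$2) - of_int m * cnj (M$2$2)],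
     vector [of_int n * cnj (M$1$1) - cnj l * cnj (M$2$1), of_int n * cnj (M$1$2) - cnj l * cnj (M$2$2)]]"
  have N: "N$1$1 = l * cnj (M$1$1) - of_int m * cnj (M$2$1)" "N$1$2 = l * cnj (M$1$2) - of_int m * cnj (M$2$2)"
    "N$2$1 = of_int n * cnj (M$1$1) - cnj l * cnj (M$2$1)" "N$2$2 = of_int n * cnj (M$1$2) - cnj l * cnj (M$2$2)"
    unfolding N_def by simp_all
  have "N$i$j \<in> O11" for i j
    using exhaust_2[of i] exhaust_2[of j]
    by (auto simp: N intro!: O11_diff O11_mult O11_cnj O l of_int_in_O11)
  then have NO: "\<forall>i j. N$i$j \<in> O11" by blast
  have "det N = (of_int m * of_int n - l * cnj l) * cnj (det M)"
    unfolding det_2 N by (simp add: algebra_simps)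
  then have dN: "det N = 1" using det1 M(2) by simp
  \<comment> \<open>Here the right side is the reflection in the hyperplane orthogonal to
    \<open>q\<close>, the negative of the inversion in \<open>q\<close>. The sign only reverses the
    orientation, which \<open>bianchi_vecs\<close> allows.\<close>
  have fN: "form_vec N = form_vec M + (2 * pedoe (form_vec M) q) *\<^sub>R q"
  proof (rule vec4_eqI)
    have "complex_of_real (form_vec N $ 1) =
      (of_int m * of_int n - l * cnj l) * of_real (form_vec M $ 1) + of_real (2 * pedoe (form_vec M) q) * of_real (q $ 1)"
      unfolding complex_of_real_pedoe form_vec_coords N q_def lattice_vec_coords by (simp add: algebra_simps)
    then have "complex_of_real (form_vec N $ 1) = of_real ((form_vec M + (2 * pedoe (form_vec M) q) *\<^sub>R q) $ 1)"
      unfolding det1 by simp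
    then show "form_vec N $ 1 = (form_vec M + (2 * pedoe (form_vec M) q) *\<^sub>R q) $ 1" by (simp only: of_real_eq_iff)
    have "complex_of_real (form_vec N $ 2) =
      (of_int m * of_int n - l * cnj l) * of_real (form_vec M $ 2) + of_real (2 * pedoe (form_vec M) q) * of_real (q $ 2)"
      unfolding complex_of_real_pedoe form_vec_coords N q_def lattice_vec_coords by (simp add: algebra_simps)
    then have "complex_of_real (form_vec N $ 2) = of_real ((form_vec M + (2 * pedoe (form_vec M) q) *\<^sub>R q) $ 2)"
      unfolding det1 by simp
    then show "form_vec N $ 2 = (form_vec M + (2 * pedoe (form_vec M) q) *\<^sub>R q) $ 2" by (simp only: of_real_eq_iff)
    have "normal_coord (form_vec N) =
      (of_int m * of_int n - l * cnj l) * normal_coord (form_vec M) + of_real (2 * pedoe (form_vec M) q) * normal_coord q"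
      unfolding complex_of_real_pedoe form_vec_coords N q_def lattice_vec_coords by (simp add: algebra_simps)
    then show "normal_coord (form_vec N) = normal_coord (form_vec M + (2 * pedoe (form_vec M) q) *\<^sub>R q)"
      unfolding det1 by (simp add: normal_coord_linear)
  qed
  have "- z - (2/11 * pedoe z (u + v)) *\<^sub>R (u + v) = - z - (2 * pedoe z q) *\<^sub>R q"
    unfolding w q_def[symmetric] by (simp add: pedoe_linear)
  then have "- z - (2/11 * pedoe z (u + v)) *\<^sub>R (u + v) = form_vec N \<or>
      - z - (2/11 * pedoe z (u + v)) *\<^sub>R (u + v) = - form_vec N"
    using M(3) fN by (auto simp: pedoe_linear)
  then show ?thesis unfolding bianchi_vecs_def using NO dN by blast
qed

section \<open>Frames\<close>

text \<open>Four points at equal mutual hyperbolic distance, with hyperbolic cosine (33/2)/11 = 3/2.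
  A set is used because tents are compared as unordered sets.\<close>

definition frame :: "(real ^ 4) set \<Rightarrow> bool" where
  "frame Q \<longleftrightarrow> card Q = 4 \<and> (\<forall>x\<in>Q. \<forall>y\<in>Q. pedoe x y = (if x = y then -11 else -33/2))"

text \<open>The vector for which the vertex circles of the tent are \<open>hub Q - x\<close>.\<close>

definition hub :: "(real ^ 4) set \<Rightarrow> real ^ 4" where
  "hub Q = (4/11) *\<^sub>R (\<Sum>x\<in>Q. x)"

text \<open>Vertex circles of the three vectors other than \<open>w\<close> alternate with the
  circles of the three edges at \<open>w\<close>; opposite members of this hexagon add up to
  \<open>w\<close>.\<close>

definition belt_vecs :: "(real ^ 4) set \<Rightarrow> real ^ 4 \<Rightarrow> (real ^ 4) set" where
  "belt_vecs Q w = (\<lambda>x. hub Q - x) ` (Q - {w}) \<union> (\<lambda>x. w + x - hub Q) ` (Q - {w})"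

text \<open>The ten circles correspond to the four vertices and the six edges of the
  tetrahedron.\<close>

definition tent_vecs :: "(real ^ 4) set \<Rightarrow> (real ^ 4) set" where
  "tent_vecs Q = (\<lambda>x. hub Q - x) ` Q \<union> {x + y - hub Q | x y. x \<in> Q \<and> y \<in> Q \<and> x \<noteq> y}"

definition swap_frame :: "(real ^ 4) set \<Rightarrow> real ^ 4 \<Rightarrow> (real ^ 4) set" where
  "swap_frame Q w = insert w ((\<lambda>x. 3 *\<^sub>R w - x) ` (Q - {w}))"

lemma frame_finite: "frame Q \<Longrightarrow> finite Q"
  unfolding frame_def using card.infinite by fastforce

lemma frame_pedoe: "frame Q \<Longrightarrow> x \<in> Q \<Longrightarrow> y \<in> Q \<Longrightarrow> pedoe x y = (if x = y then -11 else -33/2)"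
  unfolding frame_def by blast

lemma frame_other:
  assumes "frame Q" "w \<in> Q"
  obtains x where "x \<in> Q" "x \<noteq> w"
proof -
  have "card (Q - {w}) = 3" using assms frame_finite[OF assms(1)] by (simp add: frame_def)
  then have "Q - {w} \<noteq> {}" by fastforce
  then show ?thesis using that by blast
qed

text \<open>A vector of the frame has product -11 - 3 (33/2) = -121/2 with the sum of the frame. The
  factor 4/11 makes this -22, so that \<open>hub Q - x\<close> has self-product -32 + 44 - 11 = 1,
  as a circle requires.\<close>

lemma pedoe_hub:
  assumes Q: "frame Q"
  shows "x \<in> Q \<Longrightarrow> pedoe x (hub Q) = -22" "x \<in> Q \<Longrightarrow> pedoe (hub Q) x = -22" "pedoe (hub Q) (hub Q) = -32"
proof -
  have 1: "pedoe x (hub Q) = -22" if x: "x \<in> Q" for x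
  proof -
    have "pedoe x (\<Sum>y\<in>Q. y) = (\<Sum>y\<in>Q. if x = y then -11 else -33/2)"
      unfolding pedoe_sum_right using frame_pedoe[OF Q x] by (rule sum.cong[OF refl])
    also have "\<dots> = -11 + (\<Sum>y\<in>Q - {x}. -33/2)"
    proof -
      have "(\<Sum>y\<in>Q - {x}. if x = y then -11 else -33/2) = (\<Sum>y\<in>Q - {x}. -33/2 :: real)"
        by (rule sum.cong) auto
      then show ?thesis using x frame_finite[OF Q] by (simp add: sum.remove[of Q x])
    qed
    also have "\<dots> = -11 + 3 * (-33/2)"
      using x frame_finite[OF Q] Q by (simp add: frame_def)
    finally show ?thesis by (simp add: hub_def pedoe_linear)
  qed
  then show "x \<in> Q \<Longrightarrow> pedoe x (hub Q) = -22" "x \<in> Q \<Longrightarrow> pedoe (hub Q) x = -22"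
    by (simp_all add: pedoe_commute)
  have "pedoe (hub Q) (hub Q) = 4/11 * (\<Sum>x\<in>Q. pedoe x (hub Q))"
    by (subst (1) hub_def) (simp add: pedoe_linear pedoe_sum_left)
  also have "\<dots> = 4/11 * (\<Sum>x\<in>Q. -22)" using 1 by simp
  also have "\<dots> = -32" using Q by (simp add: frame_def)
  finally show "pedoe (hub Q) (hub Q) = -32" .
qed

text \<open>The Gram entries encode incidence in the tetrahedron: -13/2 for a vertex on an edge, -1
  for a vertex off an edge, -10 for opposite edges, -9/2 for two vertices or two adjacent
  edges.\<close>

lemma pedoe_tent_vecs:
  assumes Q: "frame Q" and "x \<in> Q" "y \<in> Q" "z \<in> Q" "t \<in> Q" "x \<noteq> y" "z \<noteq> t"
  shows "pedoe (hub Q - x) (hub Q - z) = (if x = z then 1 else -9/2)"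
    "pedoe (hub Q - x) (z + t - hub Q) = (if x = z \<or> x = t then -13/2 else -1)"
    "pedoe (x + y - hub Q) (z + t - hub Q) = (if {x, y} = {z, t} then 1 else if {x, y} \<inter> {z, t} = {} then -10 else -9/2)"
  using assms(2-) by (auto simp: pedoe_linear pedoe_hub[OF Q] frame_pedoe[OF Q])

lemma tent_vecs_cases:
  assumes "v \<in> tent_vecs Q"
  obtains x where "x \<in> Q" "v = hub Q - x" | x y where "x \<in> Q" "y \<in> Q" "x \<noteq> y" "v = x + y - hub Q"
  using assms unfolding tent_vecs_def by blast

text \<open>A pair of product -13/2 is a vertex \<open>x\<close> with an edge from \<open>x\<close>
  to \<open>y\<close>, and its sum is \<open>y\<close>. This recovers the frame from the tent
  without using labels.\<close>

lemma tent_vecs_sums: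
  assumes Q: "frame Q"
  shows "{u + v | u v. u \<in> tent_vecs Q \<and> v \<in> tent_vecs Q \<and> pedoe u v = -13/2} = Q"
proof (intro equalityI subsetI)
  fix w assume "w \<in> {u + v | u v. u \<in> tent_vecs Q \<and> v \<in> tent_vecs Q \<and> pedoe u v = -13/2}"
  then obtain u v where uv: "w = u + v" "u \<in> tent_vecs Q" "v \<in> tent_vecs Q" "pedoe u v = -13/2" by blast
  show "w \<in> Q"
    using uv(2)
  proof (cases rule: tent_vecs_cases)
    case (1 x)
    show ?thesis using uv(3)
    proof (cases rule: tent_vecs_cases)
      case (1 z)
      obtain t where "t \<in> Q" "t \<noteq> x" using frame_other[OF Q \<open>x \<in> Q\<close>] .
      then show ?thesis using pedoe_tent_vecs(1)[OF Q \<open>x \<in> Q\<close> \<open>t \<in> Q\<close> \<open>z \<in> Q\<close> \<open>t \<in> Q\<close>] uv(4) 1 \<open>u = hub Q - x\<close>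
        by (simp add: pedoe_linear pedoe_hub[OF Q] frame_pedoe[OF Q] \<open>x \<in> Q\<close> split: if_splits)
    next
      case (2 z t)
      then show ?thesis using 1 uv(1,4)
        by (auto simp: pedoe_linear pedoe_hub[OF Q] frame_pedoe[OF Q] split: if_splits)
    qed
  next
    case (2 x y)
    show ?thesis using uv(3)
    proof (cases rule: tent_vecs_cases)
      case (1 z)
      then show ?thesis using 2 uv(1,4)
        by (auto simp: pedoe_linear pedoe_hub[OF Q] frame_pedoe[OF Q] split: if_splits)
    next
      case (2 z t)
      then show ?thesis using \<open>x \<in> Q\<close> \<open>y \<in> Q\<close> \<open>x \<noteq> y\<close> \<open>u = x + y - hub Q\<close> uv(4)
        pedoe_tent_vecs(3)[OF Q \<open>x \<in> Q\<close> \<open>y \<in> Q\<close> \<open>z \<in> Q\<close> \<open>t \<in> Q\<close>]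
        by (simp split: if_splits)
    qed
  qed
next
  fix w assume w: "w \<in> Q"
  obtain x where x: "x \<in> Q" "x \<noteq> w" using frame_other[OF Q w] .
  have "hub Q - x \<in> tent_vecs Q" "x + w - hub Q \<in> tent_vecs Q"
    using w x unfolding tent_vecs_def by blast+
  moreover have "pedoe (hub Q - x) (x + w - hub Q) = -13/2"
    using pedoe_tent_vecs(2)[OF Q x(1) w x(1) w] x by simp
  moreover have "w = (hub Q - x) + (x + w - hub Q)" by simp
  ultimately show "w \<in> {u + v | u v. u \<in> tent_vecs Q \<and> v \<in> tent_vecs Q \<and> pedoe u v = -13/2}" by blast
qed

text \<open>The pairs of product -13/2 are the opposite members of the hexagon, so a belt alone
  reveals the vector it belongs to.\<close>

lemma belt_vecs_sums:
  assumes Q: "frame Q" and w: "w \<in> Q"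
  shows "{u + v | u v. u \<in> belt_vecs Q w \<and> v \<in> belt_vecs Q w \<and> pedoe u v = -13/2} = {w}"
proof -
  obtain x where x: "x \<in> Q" "x \<noteq> w" using frame_other[OF Q w] .
  then have "hub Q - x \<in> belt_vecs Q w" "w + x - hub Q \<in> belt_vecs Q w"
    unfolding belt_vecs_def by blast+
  moreover have "pedoe (hub Q - x) (w + x - hub Q) = -13/2"
    using pedoe_tent_vecs(2)[OF Q x(1) w w x(1)] x by simp
  moreover have "w = (hub Q - x) + (w + x - hub Q)" by simp
  ultimately have "w \<in> {u + v | u v. u \<in> belt_vecs Q w \<and> v \<in> belt_vecs Q w \<and> pedoe u v = -13/2}" by blast
  moreover have "u + v = w" if "u \<in> belt_vecs Q w" "v \<in> belt_vecs Q w" "pedoe u v = -13/2" for u v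
    using that w unfolding belt_vecs_def
    by (auto simp: pedoe_linear pedoe_hub[OF Q] frame_pedoe[OF Q] split: if_splits)
  ultimately show ?thesis by blast
qed

text \<open>Within a belt, the products \<open>1\<close> and \<open>-9/2\<close> single out the two triangles of alternate circles.\<close>

lemma belt_vecs_triangle:
  assumes Q: "frame Q" and w: "w \<in> Q"
  shows "v \<in> (\<lambda>x. hub Q - x) ` (Q - {w}) \<Longrightarrow>
      {u \<in> belt_vecs Q w. pedoe v u = 1 \<or> pedoe v u = -9/2} = (\<lambda>x. hub Q - x) ` (Q - {w})"
    "v \<in> (\<lambda>x. w + x - hub Q) ` (Q - {w}) \<Longrightarrow>
      {u \<in> belt_vecs Q w. pedoe v u = 1 \<or> pedoe v u = -9/2} = (\<lambda>x. w + x - hub Q) ` (Q - {w})"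
  using w unfolding belt_vecs_def
  by (auto simp: pedoe_linear pedoe_hub[OF Q] frame_pedoe[OF Q] split: if_splits)

section \<open>Swaps of frames and the two frames through a belt\<close>

lemma swap_frame_props:
  assumes Q: "frame Q" and w: "w \<in> Q"
  shows "frame (swap_frame Q w)" "hub (swap_frame Q w) = 4 *\<^sub>R w - hub Q"
    "w \<in> swap_frame Q w" "swap_frame Q w - {w} = (\<lambda>x. 3 *\<^sub>R w - x) ` (Q - {w})"
proof -
  have fin: "finite (Q - {w})" and c: "card (Q - {w}) = 3"
    using w frame_finite[OF Q] Q by (simp_all add: frame_def)
  have inj: "inj_on (\<lambda>x. 3 *\<^sub>R w - x) (Q - {w})" by (simp add: inj_on_def)
  have nw: "w \<notin> (\<lambda>x. 3 *\<^sub>R w - x) ` (Q - {w})"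
  proof
    assume "w \<in> (\<lambda>x. 3 *\<^sub>R w - x) ` (Q - {w})"
    then obtain x where x: "w = 3 *\<^sub>R w - x" "x \<in> Q" "x \<noteq> w" by blast
    have "pedoe w w = pedoe (3 *\<^sub>R w - x) w" using x(1) by simp
    then show False using x(2,3) w by (simp add: pedoe_linear frame_pedoe[OF Q])
  qed
  show "w \<in> swap_frame Q w" by (simp add: swap_frame_def)
  show "swap_frame Q w - {w} = (\<lambda>x. 3 *\<^sub>R w - x) ` (Q - {w})" using nw by (auto simp: swap_frame_def)
  show "frame (swap_frame Q w)"
    unfolding frame_def
  proof
    show "card (swap_frame Q w) = 4"
      using nw fin c inj by (simp add: swap_frame_def card_image)
    show "\<forall>x\<in>swap_frame Q w. \<forall>y\<in>swap_frame Q w. pedoe x y = (if x = y then -11 else -33/2)"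
    proof -
      have "3 *\<^sub>R w - x \<noteq> w" "w \<noteq> 3 *\<^sub>R w - x" if "x \<in> Q" "x \<noteq> w" for x
        using nw that by (metis DiffI imageI singletonD)+
      then show ?thesis
        using w unfolding swap_frame_def by (auto simp: pedoe_linear frame_pedoe[OF Q])
    qed
  qed
  \<comment> \<open>The hub follows the inversion as well: the three new vectors contribute 9w and
    the old sum without \<open>w\<close>, negated; after scaling by 4/11 the total 11w becomes
    4w.\<close>
  have "(\<Sum>x\<in>swap_frame Q w. x) = w + (\<Sum>x\<in>Q - {w}. 3 *\<^sub>R w - x)"
    unfolding swap_frame_def using nw fin by (simp add: sum.reindex[OF inj])
  also have "\<dots> = w + 9 *\<^sub>R w - (\<Sum>x\<in>Q - {w}. x)"
    by (simp add: sum_subtractf sum_constant_scaleR c del: sum_constant)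
  also have "\<dots> = 11 *\<^sub>R w - (\<Sum>x\<in>Q. x)"
    unfolding sum.remove[OF frame_finite[OF Q] w] by (simp add: vec_eq_iff)
  finally show "hub (swap_frame Q w) = 4 *\<^sub>R w - hub Q"
    unfolding hub_def by (simp only: scaleR_diff_right scaleR_scaleR) simp
qed

text \<open>The product of \<open>3 *\<^sub>R w - x\<close> with \<open>x\<close> is -99/2 + 11 =
  -77/2, which does not occur in a frame.\<close>

lemma swap_frame_neq:
  assumes "frame Q" "w \<in> Q" shows "swap_frame Q w \<noteq> Q"
proof
  assume e: "swap_frame Q w = Q"
  obtain x where x: "x \<in> Q" "x \<noteq> w" using frame_other[OF assms] .
  then have "3 *\<^sub>R w - x \<in> Q" using e unfolding swap_frame_def by blast
  then have "pedoe (3 *\<^sub>R w - x) x = -11 \<or> pedoe (3 *\<^sub>R w - x) x = -33/2"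
    using frame_pedoe[OF assms(1) _ x(1)] by auto
  then show False using x assms by (simp add: pedoe_linear frame_pedoe[OF assms(1)])
qed

lemma swap_vertex_eq: "4 *\<^sub>R w - h - (3 *\<^sub>R w - x) = w + x - (h :: real ^ 4)"
  by (simp add: vec_eq_iff)

text \<open>The inversion in \<open>w\<close> exchanges the two alternate triangles of the belt,
  since opposite members sum to \<open>w\<close>: the new vertex circles are the old edge circles at
  \<open>w\<close>. Hence the belt as a set survives the swap.\<close>

lemma swap_frame_vertices:
  assumes Q: "frame Q" and w: "w \<in> Q"
  shows "(\<lambda>x. hub (swap_frame Q w) - x) ` (swap_frame Q w - {w}) = (\<lambda>x. w + x - hub Q) ` (Q - {w})"
  unfolding swap_frame_props(4)[OF assms] swap_frame_props(2)[OF assms] image_image swap_vertex_eq ..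

lemma belt_vecs_swap_frame:
  assumes Q: "frame Q" and w: "w \<in> Q"
  shows "belt_vecs (swap_frame Q w) w = belt_vecs Q w"
proof -
  have e: "w + (3 *\<^sub>R w - x) - (4 *\<^sub>R w - hub Q) = hub Q - x" for x by (simp add: vec_eq_iff)
  have "(\<lambda>x. w + x - hub (swap_frame Q w)) ` (swap_frame Q w - {w}) = (\<lambda>x. hub Q - x) ` (Q - {w})"
    unfolding swap_frame_props(4)[OF assms] swap_frame_props(2)[OF assms] image_image e ..
  then show ?thesis unfolding belt_vecs_def swap_frame_vertices[OF assms] by blast
qed

text \<open>The three vertex circles sum to \<open>w\<close> plus a quarter of the hub. So
  \<open>w\<close> and the triangle give the hub, and the hub gives back the vectors.\<close>

lemma frame_from_triangle:
  assumes Q: "frame Q" and w: "w \<in> Q" and A: "A = (\<lambda>x. hub Q - x) ` (Q - {w})"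
  shows "Q = insert w ((\<lambda>a. 4 *\<^sub>R ((\<Sum>a\<in>A. a) - w) - a) ` A)"
proof -
  have c: "card (Q - {w}) = 3" using w frame_finite[OF Q] Q by (simp add: frame_def)
  have inj: "inj_on (\<lambda>x. hub Q - x) (Q - {w})" by (simp add: inj_on_def)
  have "(\<Sum>a\<in>A. a) = (\<Sum>x\<in>Q - {w}. hub Q - x)" unfolding A by (simp add: sum.reindex[OF inj])
  also have "\<dots> = 3 *\<^sub>R hub Q - (\<Sum>x\<in>Q - {w}. x)" by (simp add: sum_subtractf sum_constant_scaleR c del: sum_constant)
  also have "(\<Sum>x\<in>Q - {w}. x) = (11/4) *\<^sub>R hub Q - w"
    using w frame_finite[OF Q] by (simp add: hub_def sum.remove[of Q w])
  finally have h: "4 *\<^sub>R ((\<Sum>a\<in>A. a) - w) = hub Q" by (simp add: vec_eq_iff algebra_simps)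
  show ?thesis unfolding h unfolding A image_image using w by auto
qed

text \<open>The belt determines \<open>w\<close>, and only two of its triples can be the triangle of
  vertex circles. One choice reconstructs \<open>Q\<close>, the other its swap, which is why a belt
  lies in exactly two frames.\<close>

lemma belt_vecs_eqD:
  assumes Q: "frame Q" "w \<in> Q" and Q': "frame Q'" "w' \<in> Q'" and eq: "belt_vecs Q w = belt_vecs Q' w'"
  shows "w' = w" "Q' = Q \<or> Q' = swap_frame Q w"
proof -
  show w': "w' = w" using belt_vecs_sums[OF Q] belt_vecs_sums[OF Q'] unfolding eq by simp
  define A' where "A' = (\<lambda>x. hub Q' - x) ` (Q' - {w})"
  obtain x where "x \<in> Q'" "x \<noteq> w" using frame_other[OF Q'] w' by blast
  then obtain a where a: "a \<in> A'" unfolding A'_def by blast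
  have A': "A' = {u \<in> belt_vecs Q w. pedoe a u = 1 \<or> pedoe a u = -9/2}"
    using belt_vecs_triangle(1)[OF Q'] a unfolding eq A'_def w' by blast
  have "a \<in> belt_vecs Q' w'" using a unfolding belt_vecs_def A'_def w' by blast
  then have "a \<in> belt_vecs Q w" unfolding eq .
  then consider "a \<in> (\<lambda>x. hub Q - x) ` (Q - {w})" | "a \<in> (\<lambda>x. w + x - hub Q) ` (Q - {w})"
    unfolding belt_vecs_def by blast
  then show "Q' = Q \<or> Q' = swap_frame Q w"
  proof cases
    case 1
    then have "A' = (\<lambda>x. hub Q - x) ` (Q - {w})" unfolding A' by (rule belt_vecs_triangle(1)[OF Q])
    then show ?thesis
      using frame_from_triangle[OF Q] frame_from_triangle[OF Q', of A'] by (simp add: A'_def w')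
  next
    case 2
    then have "A' = (\<lambda>x. w + x - hub Q) ` (Q - {w})" unfolding A' by (rule belt_vecs_triangle(2)[OF Q])
    then show ?thesis
      using frame_from_triangle[OF swap_frame_props(1,3)[OF Q], of A'] frame_from_triangle[OF Q', of A']
      by (simp add: A'_def w' swap_frame_vertices[OF Q])
  qed
qed

text \<open>Six of the new circles are the old belt. The remaining four are the inverses of the
  vertex circle of \<open>w\<close> and of the three edges avoiding \<open>w\<close>; these have
  product -11 with \<open>w\<close>, so the inversion sends \<open>z\<close> to
  \<open>2 *\<^sub>R w - z\<close>.\<close>

lemma tent_vecs_swap_frame:
  assumes Q: "frame Q" and w: "w \<in> Q" and B: "tent_vecs Q \<subseteq> bianchi_vecs"
  shows "tent_vecs (swap_frame Q w) \<subseteq> bianchi_vecs"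
proof
  have inv: "2 *\<^sub>R w - z \<in> bianchi_vecs" if z: "z \<in> tent_vecs Q" "pedoe z w = -11" for z
  proof -
    obtain x where x: "x \<in> Q" "x \<noteq> w" using frame_other[OF Q w] .
    have "hub Q - x \<in> tent_vecs Q" "x + w - hub Q \<in> tent_vecs Q"
      using w x unfolding tent_vecs_def by blast+
    moreover have "pedoe (hub Q - x) (x + w - hub Q) = -13/2"
      using pedoe_tent_vecs(2)[OF Q x(1) w x(1) w] x by simp
    moreover have "(hub Q - x) + (x + w - hub Q) = w" by simp
    ultimately have "- z - (2/11 * pedoe z w) *\<^sub>R w \<in> bianchi_vecs"
      using bianchi_inversion[of "hub Q - x" "x + w - hub Q" z] B z(1) by (metis subsetD)
    then show ?thesis using z(2) by (simp add: algebra_simps)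
  qed
  have elem: "z = w \<or> (\<exists>x\<in>Q. x \<noteq> w \<and> z = 3 *\<^sub>R w - x)" if "z \<in> swap_frame Q w" for z
    using that unfolding swap_frame_def by blast
  have e: "4 *\<^sub>R w - h - w = 2 *\<^sub>R w - (h - w)" "w + (3 *\<^sub>R w - x) - (4 *\<^sub>R w - h) = h - x"
    "3 *\<^sub>R w - x + w - (4 *\<^sub>R w - h) = h - x"
    "3 *\<^sub>R w - x + (3 *\<^sub>R w - y) - (4 *\<^sub>R w - h) = 2 *\<^sub>R w - (x + y - h)" for h x y
    by (simp_all add: vec_eq_iff)
  fix v assume "v \<in> tent_vecs (swap_frame Q w)"
  then consider "v = 2 *\<^sub>R w - (hub Q - w)" | x where "x \<in> Q" "x \<noteq> w" "v = w + x - hub Q"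
    | x where "x \<in> Q" "x \<noteq> w" "v = hub Q - x"
    | x y where "x \<in> Q" "x \<noteq> w" "y \<in> Q" "y \<noteq> w" "x \<noteq> y" "v = 2 *\<^sub>R w - (x + y - hub Q)"
  proof (cases rule: tent_vecs_cases)
    case (1 z)
    then show ?thesis using elem[of z] that(1,2) unfolding swap_frame_props(2)[OF Q w]
      by (metis e(1) swap_vertex_eq)
  next
    case (2 z t)
    then show ?thesis using elem[of z] elem[of t] that(3,4) unfolding swap_frame_props(2)[OF Q w]
      by (metis e(2-4))
  qed
  then show "v \<in> bianchi_vecs"
  proof cases
    case 1
    have "hub Q - w \<in> tent_vecs Q" using w unfolding tent_vecs_def by blast
    moreover have "pedoe (hub Q - w) w = -11" using w by (simp add: pedoe_linear pedoe_hub[OF Q] frame_pedoe[OF Q])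
    ultimately show ?thesis unfolding 1 by (rule inv)
  next
    case (2 x)
    then have "v \<in> tent_vecs Q" using w unfolding tent_vecs_def by blast
    then show ?thesis using B by blast
  next
    case (3 x)
    then have "v \<in> tent_vecs Q" unfolding tent_vecs_def by blast
    then show ?thesis using B by blast
  next
    case (4 x y)
    have "x + y - hub Q \<in> tent_vecs Q" using 4 unfolding tent_vecs_def by blast
    moreover have "pedoe (x + y - hub Q) w = -11"
      using w 4 by (simp add: pedoe_linear pedoe_hub[OF Q] frame_pedoe[OF Q])
    ultimately show ?thesis unfolding 4(6) by (rule inv)
  qed
qed

text \<open>Pairing a relation with each vector shows that every coefficient is three times the sum
  S of all coefficients; adding the four gives S = 12 S.\<close>

lemma frame_independent:
  assumes Q: "frame Q"
  shows "independent Q"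
proof (rule independent_if_scalars_zero[OF frame_finite[OF Q]])
  fix f y assume f: "(\<Sum>x\<in>Q. f x *\<^sub>R x) = 0" and y: "y \<in> Q"
  have e: "f z = 3 * sum f Q" if z: "z \<in> Q" for z
  proof -
    have "0 = pedoe (\<Sum>x\<in>Q. f x *\<^sub>R x) z" unfolding f by (simp add: pedoe_linear)
    also have "\<dots> = (\<Sum>x\<in>Q. f x * pedoe x z)" by (simp add: pedoe_sum_left pedoe_linear)
    also have "\<dots> = f z * (-11) + (\<Sum>x\<in>Q - {z}. f x * (-33/2))"
      using z frame_finite[OF Q] by (simp add: sum.remove[of Q z] frame_pedoe[OF Q])
    also have "(\<Sum>x\<in>Q - {z}. f x * (-33/2)) = (sum f Q - f z) * (-33/2)"
      unfolding sum_distrib_right[symmetric] using z frame_finite[OF Q] by (simp add: sum.remove[of Q z])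
    finally show ?thesis by simp
  qed
  have "sum f Q = (\<Sum>z\<in>Q. 3 * sum f Q)" using e by (rule sum.cong[OF refl])
  then have "sum f Q = 0" using Q by (simp add: frame_def)
  then show "f y = 0" using e[OF y] by simp
qed

text \<open>A frame spans the space and the form is nondegenerate, so products with a frame identify
  a vector; this is how the circles of a tent are recognised from its Gram matrix.\<close>

lemma orthogonal_frame_zero:
  assumes Q: "frame Q" and z: "\<And>x. x \<in> Q \<Longrightarrow> pedoe v x = 0"
  shows "v = 0"
proof (rule pedoe_nondegenerate)
  fix u
  have "(UNIV :: (real ^ 4) set) \<subseteq> span Q"
    using card_ge_dim_independent[of Q UNIV] frame_independent[OF Q] Q
    by (simp add: frame_def dim_UNIV)
  then have "u \<in> span Q" by blast
  then show "pedoe v u = 0"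
    by (induction rule: span_induct_alt) (simp_all add: pedoe_linear z)
qed

section \<open>Tents as frames\<close>

definition bianchi_frames :: "(real ^ 4) set set" where
  "bianchi_frames = {Q. frame Q \<and> tent_vecs Q \<subseteq> bianchi_vecs}"

text \<open>The tent with sums \<open>a = v\<^sub>1 + v\<^sub>4\<close>, \<open>b = v\<^sub>1 + v\<^sub>8\<close>, \<open>c = v\<^sub>1 + v\<^sub>9\<close>, \<open>d = v\<^sub>3 + v\<^sub>9\<close>
  and hub \<open>h\<close>.\<close>

definition labelled_tent :: "real ^ 4 \<Rightarrow> real ^ 4 \<Rightarrow> real ^ 4 \<Rightarrow> real ^ 4 \<Rightarrow> real ^ 4 \<Rightarrow> (real ^ 4) list" where
  "labelled_tent h a b c d = [h - d, a + b - h, h - c, a + d - h, h - b, a + c - h, h - a, b + d - h, c + d - h, b + c - h]"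

lemma set_labelled_tent:
  assumes "distinct [a, b, c, d]" "Q = {a, b, c, d}" "h = hub Q"
  shows "set (labelled_tent h a b c d) = tent_vecs Q"
proof
  show "set (labelled_tent h a b c d) \<subseteq> tent_vecs Q"
    using assms(1) unfolding tent_vecs_def labelled_tent_def assms(2,3) list.set distinct.simps by blast
  have "x + y - h \<in> set (labelled_tent h a b c d)" if "x \<in> Q" "y \<in> Q" "x \<noteq> y" for x y
    using that assms(2) unfolding labelled_tent_def by (auto simp: add.commute)
  moreover have "h - x \<in> set (labelled_tent h a b c d)" if "x \<in> Q" for x
    using that assms(2) unfolding labelled_tent_def by auto
  ultimately show "tent_vecs Q \<subseteq> set (labelled_tent h a b c d)"
    using assms(3) unfolding tent_vecs_def by blast
qed

lemma belts_labelled_tent: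
  assumes "distinct [a, b, c, d]" "Q = {a, b, c, d}" "h = hub Q"
  shows "(\<lambda>i. labelled_tent h a b c d ! (i - 1)) ` {1,2,3,4,5,6} = belt_vecs Q a"
    "(\<lambda>i. labelled_tent h a b c d ! (i - 1)) ` {1,2,3,8,7,10} = belt_vecs Q b"
    "(\<lambda>i. labelled_tent h a b c d ! (i - 1)) ` {3,4,5,9,7,8} = belt_vecs Q d"
    "(\<lambda>i. labelled_tent h a b c d ! (i - 1)) ` {1,6,5,9,7,10} = belt_vecs Q c"
proof -
  have "Q - {a} = {b, c, d}" "Q - {b} = {a, c, d}" "Q - {c} = {a, b, d}" "Q - {d} = {a, b, c}"
    using assms(1,2) by auto
  moreover have "(\<lambda>i. labelled_tent h a b c d ! (i - 1)) ` {1,2,3,4,5,6} = {h - d, a + b - h, h - c, a + d - h, h - b, a + c - h}"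
    "(\<lambda>i. labelled_tent h a b c d ! (i - 1)) ` {1,2,3,8,7,10} = {h - d, b + a - h, h - c, b + d - h, h - a, b + c - h}"
    "(\<lambda>i. labelled_tent h a b c d ! (i - 1)) ` {3,4,5,9,7,8} = {h - c, d + a - h, h - b, d + c - h, h - a, d + b - h}"
    "(\<lambda>i. labelled_tent h a b c d ! (i - 1)) ` {1,6,5,9,7,10} = {h - d, c + a - h, h - b, c + d - h, h - a, c + b - h}"
    unfolding image_insert image_empty by (simp_all add: labelled_tent_def add.commute)
  ultimately show "(\<lambda>i. labelled_tent h a b c d ! (i - 1)) ` {1,2,3,4,5,6} = belt_vecs Q a"
    "(\<lambda>i. labelled_tent h a b c d ! (i - 1)) ` {1,2,3,8,7,10} = belt_vecs Q b"
    "(\<lambda>i. labelled_tent h a b c d ! (i - 1)) ` {3,4,5,9,7,8} = belt_vecs Q d"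
    "(\<lambda>i. labelled_tent h a b c d ! (i - 1)) ` {1,6,5,9,7,10} = belt_vecs Q c"
    unfolding belt_vecs_def assms(3)[symmetric] by (simp_all only: image_insert image_empty) blast+
qed

lemma gram_labelled_tent:
  assumes "frame Q" "distinct [a, b, c, d]" "Q = {a, b, c, d}" "h = hub Q"
  shows "map (\<lambda>u. map (pedoe u) (labelled_tent h a b c d)) (labelled_tent h a b c d) = tent_gram"
proof -
  have Q: "a \<in> Q" "b \<in> Q" "c \<in> Q" "d \<in> Q" using assms(3) by auto
  have p: "pedoe a a = -11" "pedoe a b = -33/2" "pedoe a c = -33/2" "pedoe a d = -33/2"
    "pedoe b a = -33/2" "pedoe b b = -11" "pedoe b c = -33/2" "pedoe b d = -33/2"
    "pedoe c a = -33/2" "pedoe c b = -33/2" "pedoe c c = -11" "pedoe c d = -33/2"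
    "pedoe d a = -33/2" "pedoe d b = -33/2" "pedoe d c = -33/2" "pedoe d d = -11"
    using Q assms(2) by (auto simp: frame_pedoe[OF assms(1)])
  have ph: "pedoe a h = -22" "pedoe b h = -22" "pedoe c h = -22" "pedoe d h = -22"
    "pedoe h a = -22" "pedoe h b = -22" "pedoe h c = -22" "pedoe h d = -22" "pedoe h h = -32"
    using Q by (simp_all add: pedoe_hub[OF assms(1)] assms(4))
  show ?thesis unfolding tent_gram_def labelled_tent_def by (simp add: pedoe_linear p ph)
qed

lemma frame_of_tent:
  assumes len: "length vs = 10"
    and gram: "\<And>i j. i < 10 \<Longrightarrow> j < 10 \<Longrightarrow> pedoe (vs ! i) (vs ! j) = tent_gram ! i ! j"
  obtains a b c d where "frame {a, b, c, d}" "distinct [a, b, c, d]"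
    "vs = labelled_tent (hub {a, b, c, d}) a b c d"
proof -
  \<comment> \<open>These are v_1 + v_4, v_1 + v_8, v_1 + v_9 and v_3 + v_9, list positions counting
    from 0. Their products, and those with every member of \<open>vs\<close>, are sums of Gram
    entries, which then pin down all ten vectors.\<close>
  define a b c d where "a = vs ! 0 + vs ! 3" and "b = vs ! 0 + vs ! 7" and "c = vs ! 0 + vs ! 8" and "d = vs ! 2 + vs ! 8"
  note abcd = a_def b_def c_def d_def
  let ?Q = "{a, b, c, d}"
  note g = gram tent_gram_def
  have p: "pedoe a a = -11" "pedoe a b = -33/2" "pedoe a c = -33/2" "pedoe a d = -33/2"
    "pedoe b a = -33/2" "pedoe b b = -11" "pedoe b c = -33/2" "pedoe b d = -33/2"
    "pedoe c a = -33/2" "pedoe c b = -33/2" "pedoe c c = -11" "pedoe c d = -33/2"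
    "pedoe d a = -33/2" "pedoe d b = -33/2" "pedoe d c = -33/2" "pedoe d d = -11"
    unfolding abcd by (simp_all add: pedoe_linear g)
  then have dist: "distinct [a, b, c, d]" by auto
  have Q: "frame ?Q" unfolding frame_def using dist p by auto
  define h where "h = hub ?Q"
  have m: "a \<in> ?Q" "b \<in> ?Q" "c \<in> ?Q" "d \<in> ?Q" by auto
  have ph: "pedoe h a = -22" "pedoe h b = -22" "pedoe h c = -22" "pedoe h d = -22"
    using m by (simp_all only: pedoe_hub[OF Q] h_def)
  have e: "v = u" if "pedoe v a = pedoe u a" "pedoe v b = pedoe u b" "pedoe v c = pedoe u c" "pedoe v d = pedoe u d" for u v
    using orthogonal_frame_zero[OF Q, of "v - u"] that by (auto simp: pedoe_linear)
  have v: "pedoe (vs ! i) a = tent_gram ! i ! 0 + tent_gram ! i ! 3" "pedoe (vs ! i) b = tent_gram ! i ! 0 + tent_gram ! i ! 7"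
    "pedoe (vs ! i) c = tent_gram ! i ! 0 + tent_gram ! i ! 8" "pedoe (vs ! i) d = tent_gram ! i ! 2 + tent_gram ! i ! 8" if "i < 10" for i
    unfolding abcd using that by (simp_all add: pedoe_linear gram)
  have "vs = labelled_tent h a b c d"
  proof (rule nth_equalityI)
    show "length vs = length (labelled_tent h a b c d)" by (simp add: len labelled_tent_def)
    fix i assume "i < length vs"
    then have "i = 0 \<or> i = 1 \<or> i = 2 \<or> i = 3 \<or> i = 4 \<or> i = 5 \<or> i = 6 \<or> i = 7 \<or> i = 8 \<or> i = 9"
      unfolding len by presburger
    then show "vs ! i = labelled_tent h a b c d ! i"
      by (elim disjE) (rule e; simp add: v tent_gram_def labelled_tent_def pedoe_linear p ph)+
  qed
  then show ?thesis using that[OF Q dist] h_def by blast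
qed

lemma frame_enumerate:
  assumes "frame Q"
  obtains a b c d where "distinct [a, b, c, d]" "Q = {a, b, c, d}"
proof -
  obtain xs where xs: "set xs = Q" "distinct xs"
    using finite_distinct_list[OF frame_finite[OF assms]] by blast
  then have "length xs = 4" using assms distinct_card[of xs] by (simp add: frame_def)
  then obtain a b c d where "xs = [a, b, c, d]"
    by (auto simp: numeral_eq_Suc length_Suc_conv)
  then show ?thesis using that xs by (metis list.set(1,2))
qed

lemma bianchi_vecs_circle_of:
  assumes "v \<in> bianchi_vecs"
  shows "circle_of v \<in> oriented_circles" "pedoe_vec (circle_of v) = v" "fst (circle_of v) \<in> bianchi_circles"
proof -
  note u = bianchi_vecs_unit[OF assms]
  show 1: "circle_of v \<in> oriented_circles" "pedoe_vec (circle_of v) = v"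
    using circle_of_unit[OF u] by simp_all
  show "fst (circle_of v) \<in> bianchi_circles" using bianchi_circle_iff[OF 1(1)] 1(2) assms by simp
qed

lemma inj_circle_of: "inj_on circle_of bianchi_vecs"
  by (metis bianchi_vecs_circle_of(2) inj_onI)

text \<open>Ordered tents are the enumerations of Bianchi frames. Every enumeration is admissible
  because the labelled Gram matrix is the same for all orders of the four vectors.\<close>

lemma is_tent_iff:
  "is_tent Cs \<longleftrightarrow> (\<exists>a b c d. {a, b, c, d} \<in> bianchi_frames \<and> distinct [a, b, c, d] \<and>
     Cs = map circle_of (labelled_tent (hub {a, b, c, d}) a b c d))" (is "?L \<longleftrightarrow> ?R")
proof
  assume L: ?L
  define vs where "vs = map pedoe_vec Cs"
  have len: "length vs = 10" using L by (simp add: is_tent_def vs_def)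
  have gram: "pedoe (vs ! i) (vs ! j) = tent_gram ! i ! j" if "i < 10" "j < 10" for i j
    using L that by (simp add: is_tent_def vs_def)
  obtain a b c d where F: "frame {a, b, c, d}" "distinct [a, b, c, d]"
    "vs = labelled_tent (hub {a, b, c, d}) a b c d"
    using frame_of_tent[OF len gram] by blast
  have "set vs \<subseteq> bianchi_vecs" using L bianchi_circle_iff by (auto simp: is_tent_def vs_def)
  then have "{a, b, c, d} \<in> bianchi_frames"
    using set_labelled_tent[OF F(2) refl refl] F(1,3) by (simp add: bianchi_frames_def)
  moreover have "map circle_of vs = Cs"
    using L oriented_circle_coords(1) by (auto simp: is_tent_def vs_def intro!: map_idI)
  ultimately show ?R using F by blast
next
  assume ?R
  then obtain a b c d where Q: "{a, b, c, d} \<in> bianchi_frames" and d: "distinct [a, b, c, d]"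
    and Cs: "Cs = map circle_of (labelled_tent (hub {a, b, c, d}) a b c d)" by blast
  define vs where "vs = labelled_tent (hub {a, b, c, d}) a b c d"
  have F: "frame {a, b, c, d}" and "set vs \<subseteq> bianchi_vecs"
    using Q set_labelled_tent[OF d refl refl] by (simp_all add: bianchi_frames_def vs_def)
  have len: "length vs = 10" by (simp add: vs_def labelled_tent_def)
  have gram: "map (\<lambda>u. map (pedoe u) vs) vs = tent_gram"
    unfolding vs_def by (rule gram_labelled_tent[OF F d refl refl])
  have "pedoe (vs ! i) (vs ! j) = tent_gram ! i ! j" if "i < 10" "j < 10" for i j
    unfolding gram[symmetric] using that by (simp add: len)
  moreover have "pedoe_vec (Cs ! i) = vs ! i" if "i < 10" for i
    using that len \<open>set vs \<subseteq> bianchi_vecs\<close> bianchi_vecs_circle_of(2)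
    by (simp add: Cs flip: vs_def) (metis nth_mem subsetD)
  moreover have "\<forall>C \<in> set Cs. C \<in> oriented_circles \<and> fst C \<in> bianchi_circles"
    using \<open>set vs \<subseteq> bianchi_vecs\<close> bianchi_vecs_circle_of(1,3) by (auto simp: Cs simp flip: vs_def)
  ultimately show ?L unfolding is_tent_def using len by (simp add: Cs flip: vs_def)
qed

definition frame_tent :: "(real ^ 4) set \<Rightarrow> ocircle set" where
  "frame_tent Q = circle_of ` tent_vecs Q"

lemma tents_eq: "tents = frame_tent ` bianchi_frames"
proof (intro equalityI subsetI)
  fix T assume "T \<in> tents"
  then obtain a b c d where Q: "{a, b, c, d} \<in> bianchi_frames" "distinct [a, b, c, d]"
    "T = set (map circle_of (labelled_tent (hub {a, b, c, d}) a b c d))"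
    unfolding tents_def is_tent_iff by blast
  then have "T = frame_tent {a, b, c, d}"
    using set_labelled_tent[OF Q(2) refl refl] by (simp add: frame_tent_def)
  then show "T \<in> frame_tent ` bianchi_frames" using Q(1) by blast
next
  fix T assume "T \<in> frame_tent ` bianchi_frames"
  then obtain Q where Q: "Q \<in> bianchi_frames" "T = frame_tent Q" by blast
  then have "frame Q" by (simp add: bianchi_frames_def)
  then obtain a b c d where d: "distinct [a, b, c, d]" "Q = {a, b, c, d}" by (rule frame_enumerate)
  then have "T = set (map circle_of (labelled_tent (hub {a, b, c, d}) a b c d))"
    using set_labelled_tent[OF d(1) refl refl] Q(2) by (simp add: frame_tent_def)
  then show "T \<in> tents" unfolding tents_def is_tent_iff using Q(1) d by blast
qed

lemma inj_frame_tent: "inj_on frame_tent bianchi_frames"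
proof (rule inj_onI)
  fix Q R assume Q: "Q \<in> bianchi_frames" and R: "R \<in> bianchi_frames" and eq: "frame_tent Q = frame_tent R"
  have FQ: "frame Q" and FR: "frame R" using Q R by (simp_all add: bianchi_frames_def)
  have tv: "tent_vecs Q = tent_vecs R"
    using eq Q R inj_on_image_eq_iff[OF inj_circle_of] by (simp add: frame_tent_def bianchi_frames_def)
  have "{u + v | u v. u \<in> tent_vecs Q \<and> v \<in> tent_vecs Q \<and> pedoe u v = -13/2}
      = {u + v | u v. u \<in> tent_vecs R \<and> v \<in> tent_vecs R \<and> pedoe u v = -13/2}" unfolding tv ..
  then show "Q = R" unfolding tent_vecs_sums[OF FQ] tent_vecs_sums[OF FR] .
qed

text \<open>Belts are read off from an arbitrary labelling of the tent. By injectivity of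
  \<open>frame_tent\<close> all labellings enumerate the same frame, and each of them yields one
  belt per vector of that frame.\<close>

lemma belts_frame_tent:
  assumes Q: "Q \<in> bianchi_frames"
  shows "belts (frame_tent Q) = {circle_of ` belt_vecs Q w | w. w \<in> Q}"
proof -
  have labels: "{(\<lambda>i. map circle_of (labelled_tent (hub R) a b c d) ! (i - 1)) ` B | B. B \<in> belt_labels}
      = {circle_of ` belt_vecs R w | w. w \<in> R}" if "distinct [a, b, c, d]" "R = {a, b, c, d}" for a b c d R
  proof -
    define F where "F = (\<lambda>B. (\<lambda>i. labelled_tent (hub R) a b c d ! (i - 1)) ` B)"
    have F: "F {1,2,3,4,5,6} = belt_vecs R a" "F {1,2,3,8,7,10} = belt_vecs R b"
      "F {3,4,5,9,7,8} = belt_vecs R d" "F {1,6,5,9,7,10} = belt_vecs R c"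
      unfolding F_def by (rule belts_labelled_tent[OF that refl])+
    have "(\<lambda>i. map circle_of (labelled_tent (hub R) a b c d) ! (i - 1)) ` B = circle_of ` F B" if "B \<in> belt_labels" for B
      unfolding F_def image_image using that
      by (intro image_cong refl nth_map) (auto simp: belt_labels_def labelled_tent_def)
    then have "{(\<lambda>i. map circle_of (labelled_tent (hub R) a b c d) ! (i - 1)) ` B | B. B \<in> belt_labels}
      = {circle_of ` F B | B. B \<in> belt_labels}" by (intro Collect_cong) metis
    also have "\<dots> = (`) circle_of ` F ` belt_labels" by blast
    also have "F ` belt_labels = belt_vecs R ` {a, b, d, c}"
      unfolding belt_labels_def image_insert image_empty F ..
    also have "(`) circle_of ` belt_vecs R ` {a, b, d, c} = {circle_of ` belt_vecs R w | w. w \<in> R}"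
      using that(2) by blast
    finally show ?thesis .
  qed
  have "frame Q" using Q by (simp add: bianchi_frames_def)
  then obtain a b c d where d: "distinct [a, b, c, d]" "Q = {a, b, c, d}" by (rule frame_enumerate)
  show ?thesis
  proof (intro equalityI subsetI)
    fix X assume "X \<in> belts (frame_tent Q)"
    then obtain Cs B where X: "X = (\<lambda>i. Cs ! (i - 1)) ` B" "is_tent Cs" "set Cs = frame_tent Q" "B \<in> belt_labels"
      unfolding belts_def by blast
    from X(2) obtain a' b' c' d' where R: "{a', b', c', d'} \<in> bianchi_frames" "distinct [a', b', c', d']"
      "Cs = map circle_of (labelled_tent (hub {a', b', c', d'}) a' b' c' d')" unfolding is_tent_iff by blast
    have "frame_tent {a', b', c', d'} = frame_tent Q"
      using X(3) R(3) set_labelled_tent[OF R(2) refl refl] by (simp add: frame_tent_def)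
    then have Q': "Q = {a', b', c', d'}" using inj_onD[OF inj_frame_tent _ R(1) Q] by simp
    have "X \<in> {(\<lambda>i. map circle_of (labelled_tent (hub Q) a' b' c' d') ! (i - 1)) ` B | B. B \<in> belt_labels}"
      using X(1,4) unfolding R(3) Q' by blast
    then show "X \<in> {circle_of ` belt_vecs Q w | w. w \<in> Q}" unfolding labels[OF R(2) Q'] .
  next
    fix X assume "X \<in> {circle_of ` belt_vecs Q w | w. w \<in> Q}"
    then obtain B where B: "B \<in> belt_labels" "X = (\<lambda>i. map circle_of (labelled_tent (hub Q) a b c d) ! (i - 1)) ` B"
      unfolding labels[OF d, symmetric] by blast
    moreover have "is_tent (map circle_of (labelled_tent (hub Q) a b c d))"
      unfolding is_tent_iff using Q d by blast
    moreover have "set (map circle_of (labelled_tent (hub Q) a b c d)) = frame_tent Q"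
      using set_labelled_tent[OF d refl] by (simp add: frame_tent_def)
    ultimately show "X \<in> belts (frame_tent Q)" unfolding belts_def by blast
  qed
qed

lemma swap_frame_bianchi:
  assumes "Q \<in> bianchi_frames" "w \<in> Q"
  shows "swap_frame Q w \<in> bianchi_frames"
  using assms swap_frame_props(1) tent_vecs_swap_frame by (simp add: bianchi_frames_def)

lemma tent_edges_iff:
  assumes Q: "Q \<in> bianchi_frames" and R: "R \<in> bianchi_frames"
  shows "{frame_tent Q, frame_tent R} \<in> tent_edges \<longleftrightarrow> (\<exists>w\<in>Q. R = swap_frame Q w)"
proof -
  have F: "frame Q" "frame R" using Q R by (simp_all add: bianchi_frames_def)
  have sub: "belt_vecs P w \<subseteq> bianchi_vecs" if "P \<in> bianchi_frames" "w \<in> P" for P w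
  proof -
    have "belt_vecs P w \<subseteq> tent_vecs P" using that(2) unfolding belt_vecs_def tent_vecs_def by blast
    then show ?thesis using that(1) by (auto simp: bianchi_frames_def)
  qed
  have "{frame_tent Q, frame_tent R} \<in> tent_edges \<longleftrightarrow>
      frame_tent Q \<noteq> frame_tent R \<and> belts (frame_tent Q) \<inter> belts (frame_tent R) \<noteq> {}"
    using Q R unfolding tent_edges_def tents_eq by (auto simp: doubleton_eq_iff)
  also have "\<dots> \<longleftrightarrow> Q \<noteq> R \<and> (\<exists>w\<in>Q. \<exists>w'\<in>R. belt_vecs Q w = belt_vecs R w')"
  proof -
    have "belts (frame_tent Q) \<inter> belts (frame_tent R) \<noteq> {} \<longleftrightarrow>
        (\<exists>w\<in>Q. \<exists>w'\<in>R. circle_of ` belt_vecs Q w = circle_of ` belt_vecs R w')"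
      unfolding belts_frame_tent[OF Q] belts_frame_tent[OF R] by blast
    also have "\<dots> \<longleftrightarrow> (\<exists>w\<in>Q. \<exists>w'\<in>R. belt_vecs Q w = belt_vecs R w')"
      by (intro bex_cong refl inj_on_image_eq_iff[OF inj_circle_of] sub Q R)
    finally show ?thesis using inj_on_eq_iff[OF inj_frame_tent Q R] by simp
  qed
  also have "\<dots> \<longleftrightarrow> (\<exists>w\<in>Q. R = swap_frame Q w)"
  proof
    assume "Q \<noteq> R \<and> (\<exists>w\<in>Q. \<exists>w'\<in>R. belt_vecs Q w = belt_vecs R w')"
    then show "\<exists>w\<in>Q. R = swap_frame Q w" using belt_vecs_eqD(2)[OF F(1) _ F(2)] by metis
  next
    assume "\<exists>w\<in>Q. R = swap_frame Q w"
    then obtain w where w: "w \<in> Q" "R = swap_frame Q w" by blast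
    then show "Q \<noteq> R \<and> (\<exists>w\<in>Q. \<exists>w'\<in>R. belt_vecs Q w = belt_vecs R w')"
      using swap_frame_neq[OF F(1) w(1)] belt_vecs_swap_frame[OF F(1) w(1)] swap_frame_props(3)[OF F(1) w(1)] by metis
  qed
  finally show ?thesis .
qed

section \<open>The tent graph\<close>

lemma swap_frame_swap_frame:
  assumes "frame Q" "w \<in> Q"
  shows "swap_frame (swap_frame Q w) w = Q"
proof -
  have "swap_frame (swap_frame Q w) w = insert w ((\<lambda>x. 3 *\<^sub>R w - x) ` (swap_frame Q w - {w}))"
    by (simp add: swap_frame_def)
  also have "\<dots> = insert w (Q - {w})"
    unfolding swap_frame_props(4)[OF assms] image_image by simp
  also have "\<dots> = Q" using assms(2) by blast
  finally show ?thesis .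
qed

text \<open>Pairing with the old hub gives -22 on the old frame but -66 + 22 = -44 on every vector
  that the swap at \<open>w\<close> creates, so \<open>w\<close> is the only old vector
  left.\<close>

lemma swap_frame_inj:
  assumes Q: "frame Q" and w: "w \<in> Q" and w': "w' \<in> Q" and eq: "swap_frame Q w = swap_frame Q w'"
  shows "w = w'"
proof (rule ccontr)
  assume "w \<noteq> w'"
  moreover have "w' \<in> swap_frame Q w" unfolding eq by (simp add: swap_frame_def)
  ultimately obtain x where x: "x \<in> Q" "w' = 3 *\<^sub>R w - x" unfolding swap_frame_def by blast
  have "pedoe w' (hub Q) = 3 * pedoe w (hub Q) - pedoe x (hub Q)" unfolding x(2) by (simp add: pedoe_linear)
  then show False using w w' x(1) by (simp add: pedoe_hub[OF Q])
qed

lemma tent_edgesD: "{S, T} \<in> tent_edges \<Longrightarrow> S \<in> tents \<and> T \<in> tents"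
  unfolding tent_edges_def by (auto simp: doubleton_eq_iff)

lemma valence_tent:
  assumes "T \<in> tents"
  shows "valence tent_edges T = 4"
proof -
  obtain Q where Q: "Q \<in> bianchi_frames" "T = frame_tent Q" using assms unfolding tents_eq by blast
  then have F: "frame Q" by (simp add: bianchi_frames_def)
  have "{e \<in> tent_edges. T \<in> e} = (\<lambda>w. {T, frame_tent (swap_frame Q w)}) ` Q"
  proof (intro equalityI subsetI)
    fix e assume "e \<in> {e \<in> tent_edges. T \<in> e}"
    then obtain S where e: "e = {T, S}" "{T, S} \<in> tent_edges"
      unfolding tent_edges_def by (auto simp: insert_commute)
    then obtain R where R: "R \<in> bianchi_frames" "S = frame_tent R"
      using tent_edgesD unfolding tents_eq by blast
    then show "e \<in> (\<lambda>w. {T, frame_tent (swap_frame Q w)}) ` Q"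
      using e tent_edges_iff[OF Q(1) R(1)] Q(2) by blast
  next
    fix e assume "e \<in> (\<lambda>w. {T, frame_tent (swap_frame Q w)}) ` Q"
    then obtain w where w: "w \<in> Q" "e = {T, frame_tent (swap_frame Q w)}" by blast
    then show "e \<in> {e \<in> tent_edges. T \<in> e}"
      using tent_edges_iff[OF Q(1) swap_frame_bianchi[OF Q(1) w(1)]] Q(2) by blast
  qed
  moreover have "inj_on (\<lambda>w. {T, frame_tent (swap_frame Q w)}) Q"
  proof (rule inj_onI)
    fix w w' assume w: "w \<in> Q" "w' \<in> Q"
      and "{T, frame_tent (swap_frame Q w)} = {T, frame_tent (swap_frame Q w')}"
    then have "frame_tent (swap_frame Q w) = frame_tent (swap_frame Q w')" by (auto simp: doubleton_eq_iff)
    then have "swap_frame Q w = swap_frame Q w'"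
      using inj_onD[OF inj_frame_tent] swap_frame_bianchi[OF Q(1)] w by blast
    then show "w = w'" by (rule swap_frame_inj[OF F w])
  qed
  ultimately show ?thesis using F by (simp add: valence_def card_image frame_def)
qed

text \<open>The invariant of the ping-pong argument, with \<open>i\<close> the index fixed by the last swap; the last
  conjunct is what makes it inductive.\<close>

definition swap_peak :: "('a \<Rightarrow> real) \<Rightarrow> 'a set \<Rightarrow> 'a \<Rightarrow> bool" where
  "swap_peak f I i \<longleftrightarrow> 0 < f i \<and> (\<forall>j\<in>I - {i}. f i < f j) \<and> (\<forall>j\<in>I - {i}. \<forall>k\<in>I - {i}. f j \<le> f k + f i)"

text \<open>Equal values c turn into 2c everywhere except at the fixed index.\<close>

lemma swap_peak_const:
  assumes "\<And>j. j \<in> I \<Longrightarrow> f j = c" "0 < c" "i \<in> I"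
    and "g i = f i" "\<And>j. j \<in> I - {i} \<Longrightarrow> g j = 3 * f i - f j"
  shows "swap_peak g I i"
  using assms by (auto simp: swap_peak_def)

text \<open>The new minimum needs f j < 2 f k, which holds by f j \<le> f k + f i < 2 f k.
  Differences only change sign under the swap, so the new last conjunct reduces to f l \<le> f j + f
  k, a weaker bound than the old one since f i < f k.\<close>

lemma swap_peak_step:
  assumes f: "swap_peak f I i" and ik: "i \<in> I" "k \<in> I" "k \<noteq> i"
    and g: "g k = f k" "\<And>j. j \<in> I - {k} \<Longrightarrow> g j = 3 * f k - f j"
  shows "swap_peak g I k"
proof -
  have i: "0 < f i" "f i < f k" using f ik by (auto simp: swap_peak_def)
  have le: "f i \<le> f j" if "j \<in> I" for j using f that by (cases "j = i") (auto simp: swap_peak_def intro: less_imp_le)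
  have tri: "f j \<le> f l + f i" if "j \<in> I" "l \<in> I" "l \<noteq> i" for j l
    using f that le[of l] i by (cases "j = i") (auto simp: swap_peak_def)
  show ?thesis unfolding swap_peak_def
  proof (intro conjI ballI)
    show "0 < g k" using g(1) i by simp
    fix j assume j: "j \<in> I - {k}"
    show "g k < g j" using tri[of j k] i j ik g(2)[OF j] g(1) by simp
    fix l assume l: "l \<in> I - {k}"
    show "g j \<le> g l + g k" unfolding g(1) g(2)[OF j] g(2)[OF l]
      using tri[of l j] tri[of l k] i j l ik by (cases "j = i") auto
  qed
qed

lemma swap_peak_image:
  assumes "swap_peak (f \<circ> s) I u" "s u = u"
  shows "swap_peak f (s ` I) u"
  using assms unfolding swap_peak_def by (auto simp: Ball_def)

text \<open>The step from one peak to the next compares two functions on a single index set, whereas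
  a swap changes the frame itself. The map \<open>s\<close> identifies the old frame with the new
  one.\<close>

lemma swap_peak_swap_frame:
  assumes "u \<in> Q"
    and "\<And>g. g u = - pedoe u p \<Longrightarrow> (\<And>x. x \<in> Q - {u} \<Longrightarrow> g x = 3 * - pedoe u p - - pedoe x p) \<Longrightarrow> swap_peak g Q u"
  shows "swap_peak (\<lambda>x. - pedoe x p) (swap_frame Q u) u"
proof -
  define s where "s = (\<lambda>x. if x = u then u else 3 *\<^sub>R u - x)"
  have "swap_peak ((\<lambda>x. - pedoe x p) \<circ> s) Q u"
    by (rule assms(2)) (auto simp: s_def pedoe_linear)
  then have "swap_peak (\<lambda>x. - pedoe x p) (s ` Q) u"
    by (rule swap_peak_image) (simp add: s_def)
  also have "s ` Q = swap_frame Q u" using assms(1) by (auto simp: s_def swap_frame_def)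
  finally show ?thesis .
qed

lemma swap_path_not_closed:
  assumes Q: "\<And>k. frame (Q k)" and w: "\<And>k. w k \<in> Q k" and swap: "\<And>k. Q (Suc k) = swap_frame (Q k) (w k)"
    and turn: "\<And>k. w (Suc k) \<noteq> w k"
  shows "Q (Suc n) \<noteq> Q 0"
proof
  \<comment> \<open>With this choice the functional takes the same value 22 on all of
    \<open>Q 0\<close>, so it starts the induction and contradicts a strict minimum if the path
    returns.\<close>
  define p where "p = hub (Q 0)"
  have peak: "swap_peak (\<lambda>x. - pedoe x p) (Q (Suc k)) (w k)" for k
  proof (induction k)
    case 0
    show ?case unfolding swap
    proof (rule swap_peak_swap_frame[OF w])
      fix g assume "g (w 0) = - pedoe (w 0) p" "\<And>x. x \<in> Q 0 - {w 0} \<Longrightarrow> g x = 3 * - pedoe (w 0) p - - pedoe x p"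
      then show "swap_peak g (Q 0) (w 0)"
        by (intro swap_peak_const[of "Q 0" "\<lambda>x. - pedoe x p" 22])
          (auto simp: p_def pedoe_hub[OF Q] w)
    qed
  next
    case (Suc k)
    have wk: "w k \<in> Q (Suc k)" unfolding swap by (rule swap_frame_props(3)[OF Q w])
    show ?case unfolding swap[of "Suc k"]
      by (rule swap_peak_swap_frame[OF w])
        (rule swap_peak_step[OF Suc.IH wk w turn], auto)
  qed
  assume eq: "Q (Suc n) = Q 0"
  have "w n \<in> Q 0" unfolding eq[symmetric] swap by (rule swap_frame_props(3)[OF Q w])
  moreover obtain x where "x \<in> Q 0" "x \<noteq> w n" using frame_other[OF Q \<open>w n \<in> Q 0\<close>] .
  ultimately show False using peak[of n] unfolding eq by (auto simp: swap_peak_def p_def pedoe_hub[OF Q])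
qed

lemma tent_forest: "is_forest tent_edges"
  unfolding is_forest_def
proof
  assume "\<exists>vs. is_cycle tent_edges vs"
  then obtain vs where n: "length vs \<ge> 3" "distinct vs"
    and E: "\<And>i. i < length vs \<Longrightarrow> {vs ! i, vs ! (Suc i mod length vs)} \<in> tent_edges"
    unfolding is_cycle_def by blast
  \<comment> \<open>The cycle is continued periodically, so that an infinite path without
    backtracking is available.\<close>
  define T where "T = (\<lambda>k. vs ! (k mod length vs))"
  have len: "length vs > 0" using n(1) by linarith
  have TE: "{T k, T (Suc k)} \<in> tent_edges" for k
    using E[of "k mod length vs"] len by (simp add: T_def mod_Suc_eq)
  have "\<exists>Q. Q \<in> bianchi_frames \<and> T k = frame_tent Q" for k
    using tent_edgesD[OF TE[of k]] unfolding tents_eq by blast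
  then obtain Q where Q: "\<And>k. Q k \<in> bianchi_frames" "\<And>k. T k = frame_tent (Q k)" by metis
  have F: "frame (Q k)" for k using Q(1)[of k] by (simp add: bianchi_frames_def)
  have "\<exists>w\<in>Q k. Q (Suc k) = swap_frame (Q k) w" for k
    using TE[of k] tent_edges_iff[OF Q(1) Q(1), of k "Suc k"] by (simp add: Q(2))
  then obtain w where w: "\<And>k. w k \<in> Q k" "\<And>k. Q (Suc k) = swap_frame (Q k) (w k)" by metis
  \<comment> \<open>Swapping twice at the same vector returns to the same tent, so vertices two
    steps apart on the cycle would coincide, impossible for length at least 3.\<close>
  have "w (Suc k) \<noteq> w k" for k
  proof
    assume "w (Suc k) = w k"
    then have "Q (Suc (Suc k)) = Q k" using w(2) swap_frame_swap_frame[OF F w(1)] by simp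
    then have "T (Suc (Suc k)) = T k" by (simp add: Q(2))
    then have "(k + 2) mod length vs = k mod length vs"
      using n(2) len by (simp add: T_def nth_eq_iff_index_eq)
    then have "length vs dvd (k + 2) - k" by (metis le_add1 mod_eq_dvd_iff_nat)
    then show False using n(1) dvd_imp_le[of "length vs" 2] by simp
  qed
  then have "Q (Suc (length vs - 1)) \<noteq> Q 0" by (rule swap_path_not_closed[of Q w, OF F w])
  moreover have "T (length vs) = T 0" by (simp add: T_def)
  then have "Q (length vs) = Q 0" using Q inj_onD[OF inj_frame_tent] by metis
  ultimately show False using len by simp
qed

section \<open>The group of swap matrices\<close>

lemma GL_simps [simp]:
  "carrier GL = {A. invertible A}" "monoid.mult GL = (**)" "one GL = mat 1"
  by (simp_all add: GL_def)

lemma group_GL: "group (GL :: (real ^ 'n ^ 'n) monoid)"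
proof (rule groupI)
  have "invertible (mat 1 :: real ^ 'n ^ 'n)" unfolding invertible_def by (rule exI[of _ "mat 1"]) simp
  then show "one GL \<in> carrier (GL :: (real ^ 'n ^ 'n) monoid)" by simp
next
  fix A :: "real ^ 'n ^ 'n" assume "A \<in> carrier GL"
  then obtain B where "A ** B = mat 1" "B ** A = mat 1" by (auto simp: invertible_def)
  then show "\<exists>B\<in>carrier GL. monoid.mult GL B A = one GL" by (auto simp: invertible_def)
qed (simp_all add: invertible_mult matrix_mul_assoc)

text \<open>Positions in \<open>swap_matrices\<close> count from 0, matrix rows from 1.\<close>

definition swap_index :: "nat \<Rightarrow> 4" where
  "swap_index i = [1, 2, 3, 4] ! i"

lemma less_4_cases: "i < 4 \<Longrightarrow> i = 0 \<or> i = 1 \<or> i = 2 \<or> i = (3::nat)"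
  by presburger

lemma swap_index_inj: "i < 4 \<Longrightarrow> j < 4 \<Longrightarrow> swap_index i = swap_index j \<Longrightarrow> i = j"
  by (auto dest!: less_4_cases simp: swap_index_def)

lemma swap_matrix_nth:
  assumes "i < 4"
  shows "swap_matrices ! i $ k $ j =
    (if k = swap_index i then if j = k then 1 else 3 else if j = k then -1 else 0)"
  using less_4_cases[OF assms] exhaust_4[of j] exhaust_4[of k]
  by (auto simp: swap_matrices_def vector_4 swap_index_def)

text \<open>A row holds the values of a linear functional on four vectors; the matrix acts on it as
  a swap, keeping the entry of \<open>w\<close> and replacing x by 3w - x.\<close>

lemma row_mult_swap_matrix:
  assumes "i < 4"
  shows "(c v* swap_matrices ! i) $ j = (if j = swap_index i then c $ j else 3 * c $ swap_index i - c $ j)"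
  using less_4_cases[OF assms] exhaust_4[of j]
  by (auto simp: vector_matrix_mult_def sum_4 swap_matrix_nth[OF assms]) (auto simp: swap_index_def)

lemma swap_matrix_involution:
  assumes "i < 4"
  shows "swap_matrices ! i ** swap_matrices ! i = mat 1"
proof -
  have "(c v* swap_matrices ! i) v* swap_matrices ! i = c" for c
    by (simp add: vec_eq_iff row_mult_swap_matrix[OF assms])
  then have e: "c v* (swap_matrices ! i ** swap_matrices ! i) = c" for c by (simp add: vector_matrix_mul_assoc)
  have "(swap_matrices ! i ** swap_matrices ! i) $ k $ j = (mat 1 :: real ^ 4 ^ 4) $ k $ j" for k j
  proof -
    have "(axis k 1 v* A) $ j = A $ k $ j" for A :: "real ^ 4 ^ 4"
      by (simp add: vector_matrix_mult_def axis_def if_distrib[of "\<lambda>x. x * _"] cong: if_cong)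
    then show ?thesis using e[of "axis k 1"] by (metis vector_matrix_mul_rid)
  qed
  then show ?thesis by (simp add: vec_eq_iff)
qed

section \<open>Reduced words and their matrices\<close>

abbreviation swap_words :: "(nat \<times> int) list set" where
  "swap_words \<equiv> reduced_words {..<4::nat} (\<lambda>_. integer_mod_group 2)"

definition word_matrix :: "(nat \<times> int) list \<Rightarrow> real ^ 4 ^ 4" where
  "word_matrix w = foldr (\<lambda>(i, g) A. swap_matrices ! i ** A) w (mat 1)"

lemma word_matrix_simps [simp]:
  "word_matrix [] = mat 1" "word_matrix ((i, g) # w) = swap_matrices ! i ** word_matrix w"
  by (simp_all add: word_matrix_def)

lemma word_matrix_append: "word_matrix (u @ v) = word_matrix u ** word_matrix v"
  by (induction u) (auto simp: matrix_mul_assoc)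

lemma swap_words_iff:
  "w \<in> swap_words \<longleftrightarrow> (\<forall>(i, g) \<in> set w. i < 4 \<and> g = 1) \<and> successively (\<lambda>x y. fst x \<noteq> fst y) w"
proof -
  have "g \<in> carrier (integer_mod_group 2) \<and> g \<noteq> 0 \<longleftrightarrow> g = 1" for g
    by (auto simp: carrier_integer_mod_group)
  then show ?thesis by (auto simp: reduced_words_def)
qed

lemma swap_words_appendD: "u @ v \<in> swap_words \<Longrightarrow> u \<in> swap_words \<and> v \<in> swap_words"
  by (auto simp: swap_words_iff successively_append_iff)

text \<open>The row of ones plays the functional that is constant on the initial frame. Rows are
  multiplied from the right, so the last letter is the last swap and the induction appends letters
  at the end.\<close>

lemma word_matrix_peak:
  assumes "w @ [(i, g)] \<in> swap_words"
  shows "swap_peak (\<lambda>j. (1 v* word_matrix (w @ [(i, g)])) $ j) UNIV (swap_index i)"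
  using assms
proof (induction w arbitrary: i g rule: rev_induct)
  case Nil
  then have i: "i < 4" by (simp add: swap_words_iff)
  show ?case
    by (rule swap_peak_const[of UNIV "\<lambda>_. 1" 1]) (simp_all add: row_mult_swap_matrix[OF i])
next
  case (snoc x w)
  obtain k h where x: "x = (k, h)" by fastforce
  have i: "i < 4" and k: "k < 4" and ik: "i \<noteq> k"
    using snoc.prems by (auto simp: swap_words_iff x successively_append_iff)
  have IH: "swap_peak (\<lambda>j. (1 v* word_matrix (w @ [x])) $ j) UNIV (swap_index k)"
    unfolding x using snoc.prems swap_words_appendD x by (intro snoc.IH) blast
  have "1 v* word_matrix ((w @ [x]) @ [(i, g)]) = (1 v* word_matrix (w @ [x])) v* swap_matrices ! i"
    unfolding word_matrix_append[of "w @ [x]"] by (simp add: vector_matrix_mul_assoc)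
  then show ?case
    using swap_index_inj[OF i k] ik
    by (intro swap_peak_step[OF IH]) (auto simp: row_mult_swap_matrix[OF i])
qed

text \<open>The position of the strict minimum in the image of the row of ones reveals the last
  letter. For the empty word the row stays constant and has no strict minimum.\<close>

lemma word_matrix_last:
  assumes "u @ [(i, g)] \<in> swap_words" "v \<in> swap_words" "word_matrix (u @ [(i, g)]) = word_matrix v"
  obtains v' where "v = v' @ [(i, g)]"
proof -
  have p: "swap_peak (\<lambda>j. (1 v* word_matrix v) $ j) UNIV (swap_index i)"
    using word_matrix_peak[OF assms(1)] unfolding assms(3) .
  have i: "i < 4" "g = 1" using assms(1) by (auto simp: swap_words_iff)
  show ?thesis
  proof (cases v rule: rev_cases)
    case Nil
    obtain j :: 4 where "j \<noteq> swap_index i"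
      by (metis zero_neq_one)
    then show ?thesis using p Nil by (auto simp: swap_peak_def)
  next
    case (snoc v' x)
    obtain k h where x: "x = (k, h)" by fastforce
    have k: "k < 4" "h = 1" using assms(2) by (auto simp: swap_words_iff snoc x)
    have p': "swap_peak (\<lambda>j. (1 v* word_matrix v) $ j) UNIV (swap_index k)"
      using word_matrix_peak assms(2) unfolding snoc x by blast
    have "swap_index k = swap_index i"
    proof (rule ccontr)
      assume "swap_index k \<noteq> swap_index i"
      then show False using p p' unfolding swap_peak_def by (metis DiffI UNIV_I less_asym singletonD)
    qed
    then show ?thesis using that[of v'] swap_index_inj[OF k(1) i(1)] k(2) i(2) snoc x by simp
  qed
qed

lemma word_matrix_inj: "inj_on word_matrix swap_words"
proof (rule inj_onI)
  fix u v assume "u \<in> swap_words" "v \<in> swap_words" "word_matrix u = word_matrix v"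
  then show "u = v"
  proof (induction u arbitrary: v rule: rev_induct)
    case Nil
    then show ?case
      by (metis append_is_Nil_conv list.distinct(1) prod.exhaust rev_exhaust word_matrix_last)
  next
    case (snoc x u)
    obtain i g where x: "x = (i, g)" by fastforce
    obtain v' where v: "v = v' @ [x]"
      using word_matrix_last[OF snoc.prems(1)[unfolded x] snoc.prems(2) snoc.prems(3)[unfolded x]] x by metis
    have i: "i < 4" using snoc.prems(1) by (simp add: swap_words_iff x)
    have "word_matrix u ** swap_matrices ! i = word_matrix v' ** swap_matrices ! i"
      using snoc.prems(3) by (simp add: v x word_matrix_append)
    \<comment> \<open>The common last letter is an involution, so multiplying by it once more
      cancels it.\<close>
    then have "word_matrix u ** (swap_matrices ! i ** swap_matrices ! i) = word_matrix v' ** (swap_matrices ! i ** swap_matrices ! i)"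
      by (simp add: matrix_mul_assoc)
    then have "word_matrix u = word_matrix v'" by (simp add: swap_matrix_involution[OF i])
    then have "u = v'" using snoc.prems swap_words_appendD v by (intro snoc.IH) blast+
    then show ?case using v by simp
  qed
qed

text \<open>Equal adjacent letters cancel in the word because 1 + 1 = 0 modulo 2, and in the
  matrices because each of them is an involution.\<close>

lemma letter_mult_swap_words:
  assumes "i < 4" "w \<in> swap_words"
  shows "letter_mult (\<lambda>_. integer_mod_group 2) (i, 1) w \<in> swap_words \<and>
    word_matrix (letter_mult (\<lambda>_. integer_mod_group 2) (i, 1) w) = swap_matrices ! i ** word_matrix w"
proof (cases w)
  case Nil
  then show ?thesis using assms(1) by (simp add: swap_words_iff)
next
  case (Cons x w')
  obtain j h where x: "x = (j, h)" by fastforce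
  have h: "h = 1" and w': "w' \<in> swap_words"
    using assms(2) by (auto simp: Cons x swap_words_iff successively_Cons)
  show ?thesis
  proof (cases "i = j")
    case True
    then show ?thesis
      using w' by (simp add: Cons x h matrix_mul_assoc swap_matrix_involution[OF assms(1), unfolded True])
  next
    case False
    then show ?thesis using assms by (simp add: Cons x h swap_words_iff)
  qed
qed

lemma free_product_mult_swap_words:
  assumes "u \<in> swap_words" "v \<in> swap_words"
  shows "foldr (letter_mult (\<lambda>_. integer_mod_group 2)) u v \<in> swap_words \<and>
    word_matrix (foldr (letter_mult (\<lambda>_. integer_mod_group 2)) u v) = word_matrix u ** word_matrix v"
  using assms(1)
proof (induction u)
  case Nil
  then show ?case using assms(2) by simp
next
  case (Cons x u)
  obtain i g where x: "x = (i, g)" by fastforce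
  have i: "i < 4" "g = 1" and u: "u \<in> swap_words"
    using Cons.prems by (auto simp: x swap_words_iff successively_Cons)
  show ?case
    using letter_mult_swap_words[OF i(1)] Cons.IH[OF u] i(2) by (simp add: x matrix_mul_assoc)
qed

lemma swap_matrix_invertible: "i < 4 \<Longrightarrow> invertible (swap_matrices ! i)"
  using swap_matrix_involution by (auto simp: invertible_def)

lemma set_swap_matrices: "set swap_matrices = (!) swap_matrices ` {..<4}"
proof -
  have "length swap_matrices = 4" by (simp add: swap_matrices_def)
  then show ?thesis by (auto simp: set_conv_nth)
qed

lemma carrier_generated_swap_matrices:
  "carrier (subgroup_generated GL (set swap_matrices)) = word_matrix ` swap_words"
proof -
  let ?S = "set swap_matrices"
  have "?S \<subseteq> carrier GL" using swap_matrix_invertible by (auto simp: set_swap_matrices)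
  then have c: "carrier (subgroup_generated GL ?S) = generate GL ?S"
    by (simp add: subgroup_generated_def Int_absorb1)
  have letter: "[(i, 1)] \<in> swap_words" "word_matrix [(i, 1)] = swap_matrices ! i" if "i < 4" for i
    using that by (simp_all add: swap_words_iff)
  show ?thesis unfolding c
  proof (intro equalityI subsetI)
    fix A assume "A \<in> generate GL ?S"
    then show "A \<in> word_matrix ` swap_words"
    proof (induction rule: generate.induct)
      case one
      have "[] \<in> swap_words" by (simp add: swap_words_iff)
      then show ?case by (metis GL_simps(3) imageI word_matrix_simps(1))
    next
      case (incl A)
      then obtain i where "i < 4" "A = swap_matrices ! i" by (auto simp: set_swap_matrices)
      then show ?case using letter by (metis imageI)
    next
      case (inv A)
      then obtain i where i: "i < 4" "A = swap_matrices ! i" by (auto simp: set_swap_matrices)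
      \<comment> \<open>Inverses of generators are again generators, so words with letters (i, 1)
        cover the generated group.\<close>
      then have "inv\<^bsub>GL\<^esub> A = A"
        using swap_matrix_involution swap_matrix_invertible by (intro group.inv_equality[OF group_GL]) simp_all
      then show ?case using letter i by (metis imageI)
    next
      case (eng A B)
      then obtain u v where uv: "u \<in> swap_words" "v \<in> swap_words" "A = word_matrix u" "B = word_matrix v" by blast
      then show ?case using free_product_mult_swap_words[OF uv(1,2)] by (metis GL_simps(2) imageI)
    qed
  next
    fix A assume "A \<in> word_matrix ` swap_words"
    then obtain w where w: "w \<in> swap_words" "A = word_matrix w" by blast
    have "word_matrix w \<in> generate GL ?S" using w(1)
    proof (induction w)
      case Nil
      show ?case using generate.one[of GL] by simp
    next
      case (Cons x w)
      obtain i g where x: "x = (i, g)" by fastforce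
      have "i < 4" "w \<in> swap_words"
        using Cons.prems by (auto simp: x swap_words_iff successively_Cons)
      then show ?case
        using generate.eng[OF generate.incl Cons.IH, of "swap_matrices ! i"] by (simp add: x set_swap_matrices)
    qed
    then show "A \<in> generate GL ?S" using w by simp
  qed
qed

lemma word_matrix_iso:
  "word_matrix \<in> iso (free_product {..<4::nat} (\<lambda>_. integer_mod_group 2)) (subgroup_generated GL (set swap_matrices))"
  unfolding iso_def hom_def bij_betw_def
  using free_product_mult_swap_words word_matrix_inj carrier_generated_swap_matrices
  by (auto simp: free_product_def subgroup_generated_def)

theorem theorem15p4:
  shows "is_forest tent_edges \<and> (\<forall>T \<in> tents. valence tent_edges T = 4) \<and>
    (\<exists>\<phi> \<in> iso (free_product {..<4::nat} (\<lambda>_. integer_mod_group 2))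
              (subgroup_generated GL (set swap_matrices)).
       \<forall>i<4. \<phi> [(i, 1)] = swap_matrices ! i)"
  using tent_forest valence_tent word_matrix_iso by (intro conjI ballI bexI[of _ word_matrix]) simp_all

end
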